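(* For any $P,Q,R\subseteq\mathbb{N}^\mathbb{N}$ the implications (b$^+$) $\Rightarrow$ (a) $\Rightarrow$ (a$^-$) $\Leftrightarrow$ (b$^-$) hold, where: (a) $[\![Q\vee P]\!]_{\Sigma^0_2}^{\bowtie}\le^1_1R$. (a$^-$) $[\![Q\vee P]\!]_{\Sigma^0_2}\le^1_1R$. (b$^+$) There are a $\Sigma^0_2$ formula $\varphi(g)\equiv\exists v\,\theta(v,g)$ with $\theta$ a $\Pi^0_1$ relation, a uniformly computable sequence $\{\Gamma_v\}_{v\in\mathbb{N}}$ of partial computable functions and a partial computable function $\Delta$ such that: if $g\in R$ satisfies $\theta(v,g)$ then $\Gamma_v(g;u)\downarrow$ for all $u$ and $\Gamma_v(g)\in P$; if $g\in R$ satisfies $\neg\theta(v,g)$ then $\Delta(g;u)\downarrow$ for all $u\le v$ and $[\Delta(g)\upharpoonright v+1]$ intersects $Q$; if $g\in R$ satisfies $\neg\exists v\,\theta(v,g)$ then $\Delta(g;u)\downarrow$ for all $u$ and $\Delta(g)\in Q$. (b$^-$) There are a $\Sigma^0_2$ formula $\varphi(g)\equiv\exists v\,\theta(v,g)$ with $\theta$ a $\Pi^0_1$ relation, a uniformly computable sequence $\{\Gamma_v\}_{v\in\mathbb{N}}$ of partial computable functions and a partial computable $\Delta$ such that: if $g\in R$ satisfies $\theta(v,g)$ then $\Gamma_v(g;u)\downarrow$ for all $u$ and $\Gamma_v(g)\in P$; if $g\in R$ satisfies $\neg\exists v\,\theta(v,g)$ then $\Delta(g;u)\downarrow$ for all $u$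 and $\Delta(g)\in Q$.
   Context: $\le^1_1$ is Medvedev reducibility: $A\le^1_1B$ iff a partial computable function maps every element of $B$ into $A$. $\Phi(g;u)$ denotes the $u$-th value of $\Phi(g)$; $[\sigma]$ is the set of infinite extensions of a string $\sigma$. Fix new symbols $\sharp,\mathtt{pass}\notin\mathbb{N}$; sequences over $\mathbb{N}\cup\{\sharp,\mathtt{pass}\}$ are identified with elements of $\mathbb{N}^\mathbb{N}$ via a fixed computable bijection of the alphabet with $\mathbb{N}$. For $\sigma\in(\mathbb{N}\cup\{\mathtt{pass}\})^{<\mathbb{N}}$, $\mathtt{content}(\sigma)$ is $\sigma$ with all occurrences of $\mathtt{pass}$ deleted. For $\tau\in(\mathbb{N}\cup\{\sharp,\mathtt{pass}\})^{<\mathbb{N}}$: $\mathtt{walk}(\tau)=\langle\rangle$ if $|\tau|\le1$, and for $|\tau|\ge2$, $\mathtt{walk}(\tau)=\mathtt{walk}(\tau^-)^\frown\langle\tau(|\tau|-1)\rangle$ if $\tau(|\tau|-2)=\sharp$ and $\mathtt{walk}(\tau)=\mathtt{walk}(\tau^-)$ otherwise, where $\tau^-$ is $\tau$ minus its last entry; i.e. $\mathtt{walk}$ records the entries immediately following each $\sharp$. For infinite $f$, $\mathtt{content}(f)=\bigcup_n\mathtt{content}(f\upharpoonright n)$ and $\mathtt{walk}(f)=\bigcup_n\mathtt{walk}(f\upharpoonright n)$. If $g$ contains only finitely many $\sharp$'s, $\mathtt{tail}(g)=(g(n_0),g(n_0+1),\dots)$ where $n_0$ is least with $g(k)\ne\sharp$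 for all $k\ge n_0$, and $\mathtt{tail}(g)^{\rightarrow1}$ is $\mathtt{tail}(g)$ with its first entry removed. Then $[\![Q\vee P]\!]^{\bowtie}_{\Sigma^0_2}=\{g\in(\mathbb{N}\cup\{\sharp\})^\mathbb{N}:\mathtt{walk}(g)\in Q$ or ($g$ has finitely many $\sharp$'s and $\mathtt{tail}(g)^{\rightarrow1}\in P$)$\}$ and $[\![Q\vee P]\!]_{\Sigma^0_2}=\{g\in(\mathbb{N}\cup\{\sharp,\mathtt{pass}\})^\mathbb{N}:\mathtt{content}(\mathtt{walk}(g))\in Q$ or ($g$ has finitely many $\sharp$'s and $\mathtt{tail}(g)^{\rightarrow1}\in P$)$\}$ (membership in $Q$ requires the sequence to be infinite). *)

theory Defs
  imports Main
begin

text \<open>Kleene's mu-recursive functions relative to an oracle \<open>g\<close>. The denotation is \<open>None\<close> where the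
  computation diverges or the list of arguments has the wrong arity.\<close>

datatype recf =
    Zero
  | Succ
  | Proj nat
  | Oracle
  | Comp recf "recf list"
  | PrimRec recf recf
  | Mu recf

primrec peval :: "recf \<Rightarrow> (nat \<Rightarrow> nat) \<Rightarrow> nat list \<Rightarrow> nat option" where
  "peval Zero g xs = Some 0"
| "peval Succ g xs = (case xs of [x] \<Rightarrow> Some (Suc x) | _ \<Rightarrow> None)"
| "peval (Proj i) g xs = (if i < length xs then Some (xs ! i) else None)"
| "peval Oracle g xs = (case xs of [x] \<Rightarrow> Some (g x) | _ \<Rightarrow> None)"
| "peval (Comp f hs) g xs =
    (let ys = map (\<lambda>h. peval h g xs) hs
     in if None \<in> set ys then None else peval f g (map the ys))"
| "peval (PrimRec f h) g xs =
    (case xs of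
      [] \<Rightarrow> None
    | n # zs \<Rightarrow>
        rec_nat (peval f g zs)
          (\<lambda>m r. case r of None \<Rightarrow> None | Some y \<Rightarrow> peval h g (m # y # zs)) n)"
| "peval (Mu f) g xs =
    (if \<exists>n. peval f g (n # xs) = Some 0 \<and> (\<forall>m<n. \<exists>y. peval f g (m # xs) = Some (Suc y))
     then Some (LEAST n. peval f g (n # xs) = Some 0)
     else None)"

text \<open>\<open>\<Phi> g u\<close> is the value \<open>\<Phi>(g;u)\<close>; so \<open>\<Phi> g\<close> is a partial sequence, and \<open>g\<close> is in the domain of
  \<open>\<Phi>\<close> as a partial function on Baire space iff \<open>\<Phi> g\<close> is everywhere defined.\<close>

type_synonym functional = "(nat \<Rightarrow> nat) \<Rightarrow> nat \<rightharpoonup> nat"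

definition partial_computable :: "functional \<Rightarrow> bool" where
  "partial_computable \<Phi> \<longleftrightarrow> (\<exists>e. \<forall>g u. \<Phi> g u = peval e g [u])"

definition uniformly_computable :: "(nat \<Rightarrow> functional) \<Rightarrow> bool" where
  "uniformly_computable \<Gamma> \<longleftrightarrow> (\<exists>e. \<forall>v g u. \<Gamma> v g u = peval e g [v, u])"

definition computable_relation :: "(nat \<Rightarrow> nat \<Rightarrow> (nat \<Rightarrow> nat) \<Rightarrow> bool) \<Rightarrow> bool" where
  "computable_relation A \<longleftrightarrow> (\<exists>e. \<forall>n v g. peval e g [n, v] = Some (if A n v g then 1 else 0))"

definition Pi01 :: "(nat \<Rightarrow> (nat \<Rightarrow> nat) \<Rightarrow> bool) \<Rightarrow> bool" where
  "Pi01 \<theta> \<longleftrightarrow> (\<exists>A. computable_relation A \<and> (\<forall>v g. \<theta> v g \<longleftrightarrow> (\<forall>n. A n v g)))"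

text \<open>A finite or infinite sequence is a partial function on an initial segment of the naturals.\<close>

definition infinite_in :: "(nat \<rightharpoonup> 'a) \<Rightarrow> (nat \<Rightarrow> 'a) set \<Rightarrow> bool" where
  "infinite_in p A \<longleftrightarrow> (\<exists>f\<in>A. \<forall>i. p i = Some (f i))"

text \<open>The initial segment of length \<open>n\<close>, or all of \<open>p\<close> before its first undefined place.\<close>

definition prefix :: "(nat \<rightharpoonup> 'a) \<Rightarrow> nat \<Rightarrow> 'a list" where
  "prefix p n = map the (takeWhile (\<lambda>x. x \<noteq> None) (map p [0..<n]))"

definition cylinder :: "'a list \<Rightarrow> (nat \<Rightarrow> 'a) set" where
  "cylinder \<sigma> = {f. \<forall>i<length \<sigma>. f i = \<sigma> ! i}"

text \<open>The union of a chain of strings ordered by extension.\<close>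

definition union_seq :: "(nat \<Rightarrow> 'a list) \<Rightarrow> nat \<rightharpoonup> 'a" where
  "union_seq \<sigma> i =
    (if \<exists>n. i < length (\<sigma> n)
     then Some (THE a. \<exists>n. i < length (\<sigma> n) \<and> a = \<sigma> n ! i)
     else None)"

definition shift :: "(nat \<Rightarrow> 'a) \<Rightarrow> nat \<Rightarrow> 'a" where
  "shift f = (\<lambda>i. f (Suc i))"

definition medvedev_le :: "(nat \<Rightarrow> nat) set \<Rightarrow> (nat \<Rightarrow> nat) set \<Rightarrow> bool"
    (infix \<open>\<le>\<^sub>M\<close> 50) where
  "A \<le>\<^sub>M B \<longleftrightarrow> (\<exists>\<Phi>. partial_computable \<Phi> \<and> (\<forall>g\<in>B. infinite_in (\<Phi> g) A))"

datatype sym = Sharp | Pass | Num nat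

primrec code :: "sym \<Rightarrow> nat" where
  "code Sharp = 0"
| "code Pass = 1"
| "code (Num n) = n + 2"

lemma bij_code: "bij code"
proof (rule bijI)
  show "inj code"
  proof (rule injI)
    fix x y assume "code x = code y"
    then show "x = y" by (cases x; cases y) auto
  qed
  have "n \<in> range code" for n
  proof -
    have "n = code (if n = 0 then Sharp else if n = 1 then Pass else Num (n - 2))" by auto
    then show ?thesis by blast
  qed
  then show "surj code" by auto
qed

definition nums :: "(nat \<Rightarrow> nat) set \<Rightarrow> (nat \<Rightarrow> sym) set" where
  "nums A = {\<lambda>i. Num (f i) | f. f \<in> A}"

definition content :: "sym list \<Rightarrow> sym list" where
  "content \<sigma> = filter (\<lambda>a. a \<noteq> Pass) \<sigma>"

fun walk :: "sym list \<Rightarrow> sym list" where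
  "walk \<tau> =
    (if length \<tau> \<le> 1 then []
     else if \<tau> ! (length \<tau> - 2) = Sharp then walk (butlast \<tau>) @ [\<tau> ! (length \<tau> - 1)]
     else walk (butlast \<tau>))"

declare walk.simps [simp del]

text \<open>\<open>content_seq\<close> takes a possibly finite sequence, since \<open>walk_seq g\<close> is finite
  when \<open>g\<close> has only finitely many sharps.\<close>

definition content_seq :: "(nat \<rightharpoonup> sym) \<Rightarrow> nat \<rightharpoonup> sym" where
  "content_seq p = union_seq (\<lambda>n. content (prefix p n))"

definition walk_seq :: "(nat \<Rightarrow> sym) \<Rightarrow> nat \<rightharpoonup> sym" where
  "walk_seq g = union_seq (\<lambda>n. walk (map g [0..<n]))"

definition tail :: "(nat \<Rightarrow> sym) \<Rightarrow> nat \<Rightarrow> sym" where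
  "tail g = (\<lambda>i. g ((LEAST n. \<forall>k\<ge>n. g k \<noteq> Sharp) + i))"

text \<open>A walk in which two sharps are adjacent contains a sharp, and is therefore not in \<open>nums Q\<close>.\<close>

definition disj_bowtie :: "(nat \<Rightarrow> nat) set \<Rightarrow> (nat \<Rightarrow> nat) set \<Rightarrow> (nat \<Rightarrow> nat) set" where
  "disj_bowtie Q P =
    {code \<circ> g | g. (\<forall>k. g k \<noteq> Pass) \<and>
      (infinite_in (walk_seq g) (nums Q) \<or>
       finite {k. g k = Sharp} \<and> shift (tail g) \<in> nums P)}"

definition disj_Sigma02 :: "(nat \<Rightarrow> nat) set \<Rightarrow> (nat \<Rightarrow> nat) set \<Rightarrow> (nat \<Rightarrow> nat) set" where
  "disj_Sigma02 Q P =
    {code \<circ> g | g.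
      infinite_in (content_seq (walk_seq g)) (nums Q) \<or>
      finite {k. g k = Sharp} \<and> shift (tail g) \<in> nums P}"

definition cond_b_plus ::
    "(nat \<Rightarrow> nat) set \<Rightarrow> (nat \<Rightarrow> nat) set \<Rightarrow> (nat \<Rightarrow> nat) set \<Rightarrow> bool" where
  "cond_b_plus P Q R \<longleftrightarrow>
    (\<exists>\<theta> \<Gamma> \<Delta>. Pi01 \<theta> \<and> uniformly_computable \<Gamma> \<and> partial_computable \<Delta> \<and>
      (\<forall>g\<in>R. \<forall>v. \<theta> v g \<longrightarrow> (\<forall>u. \<Gamma> v g u \<noteq> None) \<and> infinite_in (\<Gamma> v g) P) \<and>
      (\<forall>g\<in>R. \<forall>v. \<not> \<theta> v g \<longrightarrow>
        (\<forall>u\<le>v. \<Delta> g u \<noteq> None) \<and> cylinder (prefix (\<Delta> g) (v + 1)) \<inter> Q \<noteq> {}) \<and>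
      (\<forall>g\<in>R. \<not> (\<exists>v. \<theta> v g) \<longrightarrow> (\<forall>u. \<Delta> g u \<noteq> None) \<and> infinite_in (\<Delta> g) Q))"

definition cond_b_minus ::
    "(nat \<Rightarrow> nat) set \<Rightarrow> (nat \<Rightarrow> nat) set \<Rightarrow> (nat \<Rightarrow> nat) set \<Rightarrow> bool" where
  "cond_b_minus P Q R \<longleftrightarrow>
    (\<exists>\<theta> \<Gamma> \<Delta>. Pi01 \<theta> \<and> uniformly_computable \<Gamma> \<and> partial_computable \<Delta> \<and>
      (\<forall>g\<in>R. \<forall>v. \<theta> v g \<longrightarrow> (\<forall>u. \<Gamma> v g u \<noteq> None) \<and> infinite_in (\<Gamma> v g) P) \<and>
      (\<forall>g\<in>R. \<not> (\<exists>v. \<theta> v g) \<longrightarrow> (\<forall>u. \<Delta> g u \<noteq> None) \<and> infinite_in (\<Delta> g) Q))"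

end

theory Submission imports Defs begin

text \<open>The implications into the disjunctions rest on one functional that writes the sequence
  \<open>x\<^sub>0, y, \<dots>, y, \<sharp>, x\<^sub>1, y, \<dots>, y, \<sharp>, x\<^sub>2, \<dots>\<close>, whose block \<open>v\<close> is closed as soon as a
  counterexample to \<open>\<theta>(v,g)\<close> is found, and whose entries \<open>y\<close> are the values of \<open>\<Gamma>\<^sub>v(g)\<close>, or junk
  if the counterexample turns up before the value does. If \<open>v\<close> is least with \<open>\<theta>(v,g)\<close>, block \<open>v\<close>
  is infinite and the tail without its first entry is \<open>\<Gamma>\<^sub>v(g)\<close>; if there is no such \<open>v\<close>, the walk is
  \<open>x\<^sub>1, x\<^sub>2, \<dots>\<close>. Under (b\<open>\<^sup>+\<close>), \<open>x\<^sub>v\<^sub>+\<^sub>1 = \<Delta>(g;v)\<close> is written only after \<open>\<not>\<theta>(v,g)\<close> has been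
  verified, so it converges. Under (b\<open>\<^sup>-\<close>), \<open>x\<^sub>v\<^sub>+\<^sub>1\<close> is the next value of \<open>\<Delta>(g)\<close> if that converges
  by stage \<open>v\<close>, and a pass otherwise.

  Conversely, given \<open>h = \<Phi>(g)\<close> in the disjunction, let \<open>\<theta>(v,g)\<close> say that \<open>v\<close> is the place where the
  tail of \<open>h\<close> begins. Both kinds of argument need computations cut off after a number of stages,
  which are obtained by recursion on the program.\<close>

section \<open>Closure properties of functions computable in an oracle\<close>

definition computable :: "nat \<Rightarrow> ((nat \<Rightarrow> nat) \<Rightarrow> nat list \<Rightarrow> nat) \<Rightarrow> bool" where
  "computable n f \<longleftrightarrow> (\<exists>e. \<forall>g xs. length xs = n \<longrightarrow> peval e g xs = Some (f g xs))"

definition decidable :: "nat \<Rightarrow> ((nat \<Rightarrow> nat) \<Rightarrow> nat list \<Rightarrow> bool) \<Rightarrow> bool" where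
  "decidable n P \<longleftrightarrow> computable n (\<lambda>g xs. if P g xs then 1 else 0)"

lemma computableI:
  assumes "\<And>g xs. length xs = n \<Longrightarrow> peval e g xs = Some (f g xs)"
  shows "computable n f"
  using assms unfolding computable_def by blast

lemma computable_cong:
  assumes "computable n f" "\<And>g xs. length xs = n \<Longrightarrow> f g xs = f' g xs"
  shows "computable n f'"
  using assms unfolding computable_def by metis

lemma peval_Comp_defined:
  assumes "map (\<lambda>h. peval h g xs) hs = map Some ys"
  shows "peval (Comp f hs) g xs = peval f g ys"
  by (simp add: Let_def assms comp_def image_iff)

text \<open>Tuples of computable functions, with their length \<open>m\<close> recorded, so that
  composition and access to arguments become introduction rules that follow the shape of a
  term.\<close>

definition computable_args ::
    "nat \<Rightarrow> nat \<Rightarrow> ((nat \<Rightarrow> nat) \<Rightarrow> nat list \<Rightarrow> nat list) \<Rightarrow> bool" where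
  "computable_args n m L \<longleftrightarrow> (\<exists>es. \<forall>g xs. length xs = n \<longrightarrow>
    length (L g xs) = m \<and> map (\<lambda>e. peval e g xs) es = map Some (L g xs))"

lemma computable_args_Nil: "computable_args n 0 (\<lambda>g xs. [])"
  unfolding computable_args_def by (rule exI[of _ "[]"]) simp

lemma computable_args_Cons:
  assumes "computable n a" "computable_args n m L"
  shows "computable_args n (Suc m) (\<lambda>g xs. a g xs # L g xs)"
proof -
  obtain e where "\<And>g xs. length xs = n \<Longrightarrow> peval e g xs = Some (a g xs)"
    using assms(1) unfolding computable_def by blast
  moreover obtain es where "\<And>g xs. length xs = n \<Longrightarrow>
      length (L g xs) = m \<and> map (\<lambda>e. peval e g xs) es = map Some (L g xs)"
    using assms(2) unfolding computable_args_def by blast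
  ultimately show ?thesis
    unfolding computable_args_def by (intro exI[of _ "e # es"]) simp
qed

lemma computable_args_self: "computable_args n n (\<lambda>g xs. xs)"
  unfolding computable_args_def
  by (rule exI[of _ "map Proj [0..<n]"]) (auto intro: nth_equalityI)

lemma computable_args_tl:
  assumes "computable_args n (Suc m) L"
  shows "computable_args n m (\<lambda>g xs. tl (L g xs))"
proof -
  obtain es where es: "\<And>g xs. length xs = n \<Longrightarrow>
      length (L g xs) = Suc m \<and> map (\<lambda>e. peval e g xs) es = map Some (L g xs)"
    using assms unfolding computable_args_def by blast
  show ?thesis
    unfolding computable_args_def
    by (intro exI[of _ "tl es"]) (use es in \<open>simp add: map_tl\<close>)
qed

lemma computable_args_map:
  assumes "\<And>h. h \<in> set hs \<Longrightarrow> computable n (f h)"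
  shows "computable_args n (length hs) (\<lambda>g xs. map (\<lambda>h. f h g xs) hs)"
  using assms by (induction hs) (auto intro: computable_args_Nil computable_args_Cons)

lemma computable_nth:
  assumes "computable_args n m L" "i < m"
  shows "computable n (\<lambda>g xs. L g xs ! i)"
proof -
  obtain es where es: "\<And>g xs. length xs = n \<Longrightarrow>
      length (L g xs) = m \<and> map (\<lambda>e. peval e g xs) es = map Some (L g xs)"
    using assms(1) unfolding computable_args_def by blast
  show ?thesis
  proof (rule computableI)
    fix g and xs :: "nat list" assume l: "length xs = n"
    then have "i < length es" using es[of xs g] assms(2) by (metis length_map)
    then have "peval (es ! i) g xs = map (\<lambda>e. peval e g xs) es ! i" by simp
    then show "peval (es ! i) g xs = Some (L g xs ! i)" using es[OF l, of g] assms(2) by simp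
  qed
qed

lemma computable_comp:
  assumes "computable m f" "computable_args n m L"
  shows "computable n (\<lambda>g xs. f g (L g xs))"
proof -
  obtain e where e: "\<And>g xs. length xs = m \<Longrightarrow> peval e g xs = Some (f g xs)"
    using assms(1) unfolding computable_def by blast
  obtain es where es: "\<And>g xs. length xs = n \<Longrightarrow>
      length (L g xs) = m \<and> map (\<lambda>e. peval e g xs) es = map Some (L g xs)"
    using assms(2) unfolding computable_args_def by blast
  have "peval (Comp e es) g xs = Some (f g (L g xs))" if "length xs = n" for g xs
    using peval_Comp_defined[of g xs es "L g xs" e] es[OF that] e by metis
  then show ?thesis by (rule computableI)
qed

lemmas computable_args_intros =
  computable_args_Nil computable_args_Cons computable_args_self computable_args_tl

text \<open>Each recursion, search or bounded quantifier puts its bound variables in front of the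
  argument list, so the arguments of the outer context are met behind several
  \<open>tl\<close>.\<close>

lemmas computable_arg =
  computable_nth[OF computable_args_self]
  computable_nth[OF computable_args_tl[OF computable_args_self]]
  computable_nth[OF computable_args_tl[OF computable_args_tl[OF computable_args_self]]]
  computable_nth[OF computable_args_tl[OF computable_args_tl[OF computable_args_tl[OF
    computable_args_self]]]]

lemma computable_Suc:
  assumes "computable n a"
  shows "computable n (\<lambda>g xs. Suc (a g xs))"
proof -
  have "computable (Suc 0) (\<lambda>g xs. Suc (xs ! 0))"
    by (rule computableI[where e = Succ]) (auto simp: length_Suc_conv)
  from computable_comp[OF this computable_args_Cons[OF assms computable_args_Nil]]
  show ?thesis by simp
qed

lemma computable_oracle:
  assumes "computable n a"
  shows "computable n (\<lambda>g xs. g (a g xs))"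
proof -
  have "computable (Suc 0) (\<lambda>g xs. g (xs ! 0))"
    by (rule computableI[where e = Oracle]) (auto simp: length_Suc_conv)
  from computable_comp[OF this computable_args_Cons[OF assms computable_args_Nil]]
  show ?thesis by simp
qed

lemma computable_const: "computable n (\<lambda>g xs. c)"
proof (induction c)
  case 0
  show ?case by (rule computableI[where e = Zero]) simp
next
  case (Suc c)
  then show ?case by (rule computable_Suc)
qed

text \<open>\<open>PrimRec\<close> does it, since base and step are total and the
  \<open>None\<close> branch is never taken. \<open>h\<close> receives counter, previous value and
  parameters in the order in which \<open>PrimRec\<close> lists them.\<close>

lemma computable_rec:
  assumes a: "computable n a" and b: "computable n b"
    and h: "computable (Suc (Suc n)) (\<lambda>g ys. h g (ys ! 0) (tl ys ! 0) (tl (tl ys)))"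
  shows "computable n (\<lambda>g xs. rec_nat (a g xs) (\<lambda>m y. h g m y xs) (b g xs))"
proof -
  obtain ea where ea: "\<And>g xs. length xs = n \<Longrightarrow> peval ea g xs = Some (a g xs)"
    using a unfolding computable_def by blast
  obtain eh where eh: "\<And>g ys. length ys = Suc (Suc n) \<Longrightarrow>
      peval eh g ys = Some (h g (ys ! 0) (tl ys ! 0) (tl (tl ys)))"
    using h unfolding computable_def by blast
  have "computable (Suc n) (\<lambda>g ys. rec_nat (a g (tl ys)) (\<lambda>m y. h g m y (tl ys)) (ys ! 0))"
  proof (rule computableI[where e = "PrimRec ea eh"])
    fix g and ys :: "nat list" assume "length ys = Suc n"
    then obtain k xs where ys: "ys = k # xs" "length xs = n" by (auto simp: length_Suc_conv)
    have "rec_nat (peval ea g xs)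
        (\<lambda>m r. case r of None \<Rightarrow> None | Some y \<Rightarrow> peval eh g (m # y # xs)) k
      = Some (rec_nat (a g xs) (\<lambda>m y. h g m y xs) k)"
      by (induction k) (simp_all add: ea eh ys)
    then show "peval (PrimRec ea eh) g ys
        = Some (rec_nat (a g (tl ys)) (\<lambda>m y. h g m y (tl ys)) (ys ! 0))"
      by (simp add: ys)
  qed
  from computable_comp[OF this computable_args_Cons[OF b computable_args_self]]
  show ?thesis by simp
qed

text \<open>A case distinction is a recursion whose step ignores the counter and the previous
  value.\<close>

lemma computable_if0:
  assumes "computable n a" "computable n b" "computable n c"
  shows "computable n (\<lambda>g xs. if a g xs = 0 then b g xs else c g xs)"
proof -
  have "computable (Suc (Suc n)) (\<lambda>g ys. c g (tl (tl ys)))"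
    by (rule computable_comp[OF assms(3)]) (intro computable_args_intros)
  from computable_rec[OF assms(2,1), where h = "\<lambda>g m y xs. c g xs", OF this]
  show ?thesis
  proof (rule computable_cong)
    fix g xs
    show "rec_nat (b g xs) (\<lambda>m y. c g xs) (a g xs) = (if a g xs = 0 then b g xs else c g xs)"
      by (cases "a g xs") simp_all
  qed
qed

lemma computable_pred:
  assumes "computable n a"
  shows "computable n (\<lambda>g xs. a g xs - 1)"
proof -
  have "computable n (\<lambda>g xs. rec_nat 0 (\<lambda>m y. m) (a g xs))"
    by (intro computable_rec computable_const assms computable_arg) simp
  then show ?thesis
  proof (rule computable_cong)
    fix g xs
    show "rec_nat 0 (\<lambda>m y. m) (a g xs) = a g xs - 1" by (cases "a g xs") simp_all
  qed
qed

lemma computable_add: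
  assumes "computable n a" "computable n b"
  shows "computable n (\<lambda>g xs. a g xs + b g xs)"
proof -
  have "computable n (\<lambda>g xs. rec_nat (a g xs) (\<lambda>m y. Suc y) (b g xs))"
    by (intro computable_rec computable_Suc assms computable_arg) simp
  moreover have "rec_nat k (\<lambda>m. Suc) l = k + l" for k l
    by (induction l) simp_all
  ultimately show ?thesis by simp
qed

lemma computable_diff:
  assumes "computable n a" "computable n b"
  shows "computable n (\<lambda>g xs. a g xs - b g xs)"
proof -
  have "computable n (\<lambda>g xs. rec_nat (a g xs) (\<lambda>m y. y - 1) (b g xs))"
    by (intro computable_rec computable_pred assms computable_arg) simp
  moreover have "rec_nat k (\<lambda>m y. y - 1) l = k - l" for k l :: nat
    by (induction l) simp_all
  ultimately show ?thesis by simp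
qed

section \<open>Definition by cases and decidable predicates\<close>

lemma computable_if:
  assumes "decidable n P" "computable n a" "computable n b"
  shows "computable n (\<lambda>g xs. if P g xs then a g xs else b g xs)"
  by (rule computable_cong[OF computable_if0[OF assms(1)[unfolded decidable_def] assms(3,2)]]) simp

lemma decidable_cong:
  assumes "decidable n P" "\<And>g xs. length xs = n \<Longrightarrow> P g xs = P' g xs"
  shows "decidable n P'"
  using assms unfolding decidable_def by (auto elim: computable_cong)

lemma decidable_eq_0:
  assumes "computable n a"
  shows "decidable n (\<lambda>g xs. a g xs = 0)"
  unfolding decidable_def by (intro computable_if0 computable_const assms)

lemma decidable_not:
  assumes "decidable n P"
  shows "decidable n (\<lambda>g xs. \<not> P g xs)"
  by (rule decidable_cong[OF decidable_eq_0[OF assms[unfolded decidable_def]]]) simp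

lemma decidable_conj:
  assumes "decidable n P" "decidable n P'"
  shows "decidable n (\<lambda>g xs. P g xs \<and> P' g xs)"
  unfolding decidable_def
  by (rule computable_cong[OF computable_if[OF assms(1) assms(2)[unfolded decidable_def]
        computable_const[of n 0]]]) simp

lemma decidable_disj:
  assumes "decidable n P" "decidable n P'"
  shows "decidable n (\<lambda>g xs. P g xs \<or> P' g xs)"
  by (rule decidable_cong[OF decidable_not[OF decidable_conj[OF assms[THEN decidable_not]]]]) simp

lemma decidable_imp:
  assumes "decidable n P" "decidable n P'"
  shows "decidable n (\<lambda>g xs. P g xs \<longrightarrow> P' g xs)"
  by (rule decidable_cong[OF decidable_disj[OF decidable_not[OF assms(1)] assms(2)]]) simp

lemma decidable_le:
  assumes "computable n a" "computable n b"
  shows "decidable n (\<lambda>g xs. a g xs \<le> b g xs)"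
  by (rule decidable_cong[OF decidable_eq_0[OF computable_diff[OF assms]]]) simp

lemma decidable_less:
  assumes "computable n a" "computable n b"
  shows "decidable n (\<lambda>g xs. a g xs < b g xs)"
  by (rule decidable_cong[OF decidable_not[OF decidable_le[OF assms(2,1)]]]) auto

lemma decidable_eq:
  assumes "computable n a" "computable n b"
  shows "decidable n (\<lambda>g xs. a g xs = b g xs)"
  by (rule decidable_cong[OF decidable_conj[OF decidable_le[OF assms] decidable_le[OF assms(2,1)]]])
     auto

section \<open>Minimization, bounded quantifiers and search\<close>

definition search :: "(nat \<Rightarrow> nat) \<Rightarrow> nat option" where
  "search t = (if \<exists>s. t s \<noteq> 0 then Some (t (LEAST s. t s \<noteq> 0) - 1) else None)"

text \<open>\<open>Mu\<close> looks for a zero, so it is applied to the characteristic function of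
  the negation. That function is total, with value 1 below the least witness, so the side condition
  of \<open>Mu\<close> on smaller arguments holds.\<close>

lemma Mu_decidable:
  assumes "decidable (Suc n) (\<lambda>g ys. P g (ys ! 0) (tl ys))"
  obtains e where "\<And>g xs. length xs = n \<Longrightarrow>
    peval e g xs = (if \<exists>k. P g k xs then Some (LEAST k. P g k xs) else None)"
proof -
  obtain d where d: "\<And>g ys. length ys = Suc n \<Longrightarrow>
      peval d g ys = Some (if \<not> P g (ys ! 0) (tl ys) then 1 else 0)"
    using decidable_not[OF assms] unfolding decidable_def computable_def by blast
  have "peval (Mu d) g xs = (if \<exists>k. P g k xs then Some (LEAST k. P g k xs) else None)"
    if l: "length xs = n" for g xs
  proof -
    have d0: "peval d g (k # xs) = Some 0 \<longleftrightarrow> P g k xs"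
      "(\<exists>y. peval d g (k # xs) = Some (Suc y)) \<longleftrightarrow> \<not> P g k xs" for k
      using d[of "k # xs" g] l by auto
    have "(\<exists>k. P g k xs \<and> (\<forall>m<k. \<not> P g m xs)) \<longleftrightarrow> (\<exists>k. P g k xs)"
      using LeastI_ex[of "\<lambda>k. P g k xs"] not_less_Least[of _ "\<lambda>k. P g k xs"] by metis
    then show ?thesis by (simp add: d0)
  qed
  then show ?thesis by (rule that)
qed

lemma computable_Least:
  assumes "decidable (Suc n) (\<lambda>g ys. P g (ys ! 0) (tl ys))"
    and "\<And>g xs. length xs = n \<Longrightarrow> \<exists>k. P g k xs"
  shows "computable n (\<lambda>g xs. LEAST k. P g k xs)"
proof -
  obtain e where e: "\<And>g xs. length xs = n \<Longrightarrow>
      peval e g xs = (if \<exists>k. P g k xs then Some (LEAST k. P g k xs) else None)"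
    using Mu_decidable[OF assms(1)] by blast
  show ?thesis
    by (rule computableI[where e = e]) (use e assms(2) in auto)
qed

text \<open>Search for the least \<open>k\<close> that is out of range or violates \<open>P\<close>.
  The bound itself is out of range, so the search is total, and the quantifier holds iff nothing
  below the bound is found.\<close>

lemma decidable_ball:
  assumes P: "decidable (Suc n) (\<lambda>g ys. P g (ys ! 0) (tl ys))" and b: "computable n b"
  shows "decidable n (\<lambda>g xs. \<forall>k<b g xs. P g k xs)"
proof -
  have "computable n (\<lambda>g xs. LEAST k. \<not> (k < b g xs \<and> P g k xs))"
    by (intro computable_Least decidable_not decidable_conj decidable_less P computable_arg
        computable_comp[OF b] computable_args_intros) auto
  from decidable_le[OF b this] show ?thesis
  proof (rule decidable_cong)
    fix g xs
    show "b g xs \<le> (LEAST k. \<not> (k < b g xs \<and> P g k xs)) \<longleftrightarrow> (\<forall>k<b g xs. P g k xs)"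
    proof
      assume "b g xs \<le> (LEAST k. \<not> (k < b g xs \<and> P g k xs))"
      then show "\<forall>k<b g xs. P g k xs"
        using not_less_Least[of _ "\<lambda>k. \<not> (k < b g xs \<and> P g k xs)"] by (meson order_less_le_trans)
    next
      assume P: "\<forall>k<b g xs. P g k xs"
      have "\<not> ((LEAST k. \<not> (k < b g xs \<and> P g k xs)) < b g xs \<and>
            P g (LEAST k. \<not> (k < b g xs \<and> P g k xs)) xs)"
        by (rule LeastI[of _ "b g xs"]) simp
      with P show "b g xs \<le> (LEAST k. \<not> (k < b g xs \<and> P g k xs))" by (meson not_less)
    qed
  qed
qed

text \<open>Minimization finds the first stage with a nonzero value; a composition then evaluates
  \<open>t\<close> there and takes off the marking successor.\<close>

lemma peval_search:
  assumes "computable (Suc n) (\<lambda>g ys. t g (ys ! 0) (tl ys))"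
  obtains e where "\<And>g xs. length xs = n \<Longrightarrow> peval e g xs = search (\<lambda>s. t g s xs)"
proof -
  obtain m where m: "\<And>g xs. length xs = n \<Longrightarrow>
      peval m g xs = (if \<exists>s. t g s xs \<noteq> 0 then Some (LEAST s. t g s xs \<noteq> 0) else None)"
    using Mu_decidable[OF decidable_not[OF decidable_eq_0[OF assms]]] by blast
  obtain d where d: "\<And>g ys. length ys = Suc n \<Longrightarrow>
      peval d g ys = Some (t g (ys ! 0) (tl ys) - 1)"
    using computable_pred[OF assms] unfolding computable_def by blast
  have "peval (Comp d (m # map Proj [0..<n])) g xs = search (\<lambda>s. t g s xs)"
    if l: "length xs = n" for g xs
  proof -
    have proj: "map (\<lambda>h. peval h g xs) (map Proj [0..<n]) = map Some xs"
      using l by (intro nth_equalityI) auto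
    show ?thesis
    proof (cases "\<exists>s. t g s xs \<noteq> 0")
      case True
      then have "peval (Comp d (m # map Proj [0..<n])) g xs
          = peval d g ((LEAST s. t g s xs \<noteq> 0) # xs)"
        using proj l by (intro peval_Comp_defined) (simp add: m)
      with True l show ?thesis by (simp add: search_def d del: peval.simps)
    next
      case False
      with l show ?thesis by (simp add: search_def m Let_def)
    qed
  qed
  then show ?thesis by (rule that)
qed

lemmas computable_intros =
  computable_const computable_arg computable_Suc computable_pred computable_add computable_diff
  computable_if decidable_eq decidable_le decidable_less decidable_not decidable_conj
  decidable_disj decidable_imp decidable_ball computable_args_intros

section \<open>Approximation of computations by stages\<close>

text \<open>\<open>t s\<close> is \<open>0\<close> if the computation of \<open>p\<close> has not been found to halt by stage \<open>s\<close>,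
  and the successor of the result otherwise.\<close>

definition stages :: "(nat \<Rightarrow> nat) \<Rightarrow> nat option \<Rightarrow> bool" where
  "stages t p \<longleftrightarrow>
    (\<forall>s y. t s = Suc y \<longrightarrow> p = Some y) \<and> (\<forall>y. p = Some y \<longrightarrow> (\<exists>r. \<forall>s\<ge>r. t s = Suc y))"

lemma stages_const: "stages (\<lambda>s. Suc y) (Some y)" "stages (\<lambda>s. 0) None"
  unfolding stages_def by auto

lemma stages_sound: "stages t p \<Longrightarrow> t s = Suc y \<Longrightarrow> p = Some y"
  unfolding stages_def by blast

lemma stages_limit: "stages t (Some y) \<Longrightarrow> \<exists>r. \<forall>s\<ge>r. t s = Suc y"
  unfolding stages_def by blast

lemma stages_halts:
  assumes "stages t (Some y)"
  obtains s where "t s = Suc y"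
  using stages_limit[OF assms] that by blast

lemma stages_None: "stages t None \<Longrightarrow> t s = 0"
  unfolding stages_def by (cases "t s") auto

text \<open>Subcomputations halt at different stages; this provides a common one for finitely many
  of them.\<close>

lemma uniform_limit_stage:
  fixes n :: nat
  assumes "\<And>i. i < n \<Longrightarrow> \<exists>r. \<forall>s\<ge>r. P i s"
  shows "\<exists>r::nat. \<forall>s\<ge>r. \<forall>i<n. P i s"
  using assms
proof (induction n)
  case 0
  show ?case by simp
next
  case (Suc n)
  then obtain r where r: "\<forall>s\<ge>r. \<forall>i<n. P i s" by auto
  obtain r' where r': "\<forall>s\<ge>r'. P n s" using Suc.prems by blast
  have "\<forall>s\<ge>max r r'. \<forall>i<Suc n. P i s" using r r' by (auto simp: less_Suc_eq)
  then show ?case by blast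
qed

lemma search_Some:
  assumes "\<exists>s. t s \<noteq> 0" "\<And>s. t s \<noteq> 0 \<Longrightarrow> t s = Suc y"
  shows "search t = Some y"
proof -
  have "t (LEAST s. t s \<noteq> 0) = Suc y" using assms(2)[OF LeastI_ex[OF assms(1)]] .
  then show ?thesis using assms(1) unfolding search_def by simp
qed

text \<open>By recursion on the program: \<open>T\<close> runs the subcomputations for the same
  \<open>s\<close> stages and is 0 unless all those that are needed have halted.
  \<open>stages\<close> demands the result at all large stages, so subcomputations that halt at
  different times can be combined at a later common stage.\<close>

lemma normal_form:
  "\<exists>T. computable (Suc n) T \<and>
    (\<forall>g xs. length xs = n \<longrightarrow> stages (\<lambda>s. T g (s # xs)) (peval e g xs))"
proof (induction e arbitrary: n)
  case Zero
  show ?case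
    by (rule exI[of _ "\<lambda>g ys. Suc 0"]) (auto intro: computable_const stages_const)
next
  case Succ
  show ?case
  proof (cases "n = Suc 0")
    case True
    \<comment> \<open>The head of \<open>ys\<close> is the stage. One \<open>Suc\<close> belongs to
      the program, the other marks halting.\<close>
    have "computable (Suc n) (\<lambda>g ys. Suc (Suc (ys ! 1)))"
      by (intro computable_intros) (simp add: True)
    then show ?thesis
      by (intro exI[of _ "\<lambda>g ys. Suc (Suc (ys ! 1))"])
        (auto simp: True length_Suc_conv intro: stages_const)
  next
    case False
    then show ?thesis
      by (intro exI[of _ "\<lambda>g ys. 0"])
        (auto intro: computable_const stages_const split: list.split)
  qed
next
  case (Proj i)
  show ?case
  proof (cases "i < n")
    case True
    have "computable (Suc n) (\<lambda>g ys. Suc (ys ! Suc i))"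
      by (intro computable_intros) (simp add: True)
    then show ?thesis
      by (intro exI[of _ "\<lambda>g ys. Suc (ys ! Suc i)"])
        (auto simp: True intro: stages_const)
  next
    case False
    then show ?thesis
      by (intro exI[of _ "\<lambda>g ys. 0"]) (auto intro: computable_const stages_const)
  qed
next
  case Oracle
  show ?case
  proof (cases "n = Suc 0")
    case True
    have "computable (Suc n) (\<lambda>g ys. Suc (g (ys ! 1)))"
      by (intro computable_oracle computable_intros) (simp add: True)
    then show ?thesis
      by (intro exI[of _ "\<lambda>g ys. Suc (g (ys ! 1))"])
        (auto simp: True length_Suc_conv intro: stages_const)
  next
    case False
    then show ?thesis
      by (intro exI[of _ "\<lambda>g ys. 0"])
        (auto intro: computable_const stages_const split: list.split)
  qed
next
  case (Comp e ds)
  obtain F where F: "computable (Suc (length ds)) F"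
    "\<And>g xs. length xs = length ds \<Longrightarrow> stages (\<lambda>s. F g (s # xs)) (peval e g xs)"
    using Comp.IH(1) by blast
  have "\<forall>d\<in>set ds. \<exists>T. computable (Suc n) T \<and>
      (\<forall>g xs. length xs = n \<longrightarrow> stages (\<lambda>s. T g (s # xs)) (peval d g xs))"
    using Comp.IH(2) by blast
  then obtain D where D: "\<And>d. d \<in> set ds \<Longrightarrow> computable (Suc n) (D d)"
    "\<And>d g xs. d \<in> set ds \<Longrightarrow> length xs = n \<Longrightarrow> stages (\<lambda>s. D d g (s # xs)) (peval d g xs)"
    by metis
  \<comment> \<open>Each \<open>D d\<close> carries the marking successor, which is removed before
    the values are handed to \<open>F\<close>.\<close>
  define T where "T = (\<lambda>g ys. if \<forall>i<length ds. D (ds ! i) g ys \<noteq> 0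
    then F g (ys ! 0 # map (\<lambda>d. D d g ys - 1) ds) else 0)"
  \<comment> \<open>The \<open>D d\<close> need not be uniform in \<open>d\<close>, so this is a
    finite conjunction built along a fixed list, not a bounded quantifier over an index.\<close>
  have "decidable (Suc n) (\<lambda>g ys. \<forall>d\<in>set ds'. D d g ys \<noteq> 0)" if "set ds' \<subseteq> set ds" for ds'
    using that
  proof (induction ds')
    case Nil
    then show ?case by (simp add: decidable_def computable_const)
  next
    case (Cons d ds')
    then have "decidable (Suc n) (\<lambda>g ys. \<not> D d g ys = 0 \<and> (\<forall>d\<in>set ds'. D d g ys \<noteq> 0))"
      by (intro decidable_conj decidable_not decidable_eq_0 D(1)) auto
    then show ?case by simp
  qed
  from this[of ds] have "decidable (Suc n) (\<lambda>g ys. \<forall>i<length ds. D (ds ! i) g ys \<noteq> 0)"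
    by (simp add: all_set_conv_all_nth)
  moreover have "computable (Suc n) (\<lambda>g ys. F g (ys ! 0 # map (\<lambda>d. D d g ys - 1) ds))"
    by (rule computable_comp[OF F(1)])
      (intro computable_args_Cons computable_args_map computable_arg computable_pred D(1); simp)
  ultimately have "computable (Suc n) T"
    unfolding T_def by (intro computable_if computable_const)
  moreover have "stages (\<lambda>s. T g (s # xs)) (peval (Comp e ds) g xs)" if l: "length xs = n" for g xs
  proof (cases "\<exists>ys. map (\<lambda>d. peval d g xs) ds = map Some ys")
    case True
    then obtain ys where ys: "map (\<lambda>d. peval d g xs) ds = map Some ys" by blast
    have ly: "length ys = length ds" using ys by (metis length_map)
    have nth: "peval (ds ! i) g xs = Some (ys ! i)" if "i < length ds" for i
      using arg_cong[OF ys, of "\<lambda>zs. zs ! i"] that ly by simp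
    have D_nth: "stages (\<lambda>s. D (ds ! i) g (s # xs)) (Some (ys ! i))" if "i < length ds" for i
      using D(2)[of "ds ! i" xs g] nth[OF that] that l by simp
    have F_ys: "stages (\<lambda>s. F g (s # ys)) (peval e g ys)" using F(2) ly by blast
    have T_eq: "T g (s # xs) = F g (s # ys)"
      if "\<forall>i<length ds. D (ds ! i) g (s # xs) \<noteq> 0" for s
    proof -
      have "D (ds ! i) g (s # xs) - 1 = ys ! i" if "i < length ds" for i
        using stages_sound[OF D_nth[OF that], of s "D (ds ! i) g (s # xs) - 1"]
          \<open>\<forall>i<length ds. D (ds ! i) g (s # xs) \<noteq> 0\<close> that by simp
      then have "map (\<lambda>d. D d g (s # xs) - 1) ds = ys"
        using ly by (intro nth_equalityI) auto
      then show ?thesis using that by (simp add: T_def)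
    qed
    have "\<exists>r. \<forall>s\<ge>r. \<forall>i<length ds. D (ds ! i) g (s # xs) = Suc (ys ! i)"
      by (intro uniform_limit_stage stages_limit D_nth)
    then obtain r where r: "\<And>s i. s \<ge> r \<Longrightarrow> i < length ds \<Longrightarrow> D (ds ! i) g (s # xs) \<noteq> 0"
      by (metis nat.distinct(1))
    have "peval e g ys = Some y" if "T g (s # xs) = Suc y" for s y
    proof -
      have "\<forall>i<length ds. D (ds ! i) g (s # xs) \<noteq> 0"
        using that by (auto simp: T_def split: if_splits)
      then show ?thesis using T_eq that stages_sound[OF F_ys] by metis
    qed
    moreover have "\<exists>r. \<forall>s\<ge>r. T g (s # xs) = Suc y" if y: "peval e g ys = Some y" for y
    proof -
      obtain r' where "\<forall>s\<ge>r'. F g (s # ys) = Suc y"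
        using stages_limit[OF F_ys[unfolded y]] by blast
      then have "\<forall>s\<ge>max r r'. T g (s # xs) = Suc y" using T_eq r by simp
      then show ?thesis by blast
    qed
    ultimately show ?thesis unfolding peval_Comp_defined[OF ys] stages_def by blast
  next
    case False
    have "\<exists>d\<in>set ds. peval d g xs = None"
    proof (rule ccontr)
      assume "\<not> ?thesis"
      then have "map (\<lambda>d. peval d g xs) ds = map Some (map (\<lambda>d. the (peval d g xs)) ds)" by auto
      with False show False by blast
    qed
    then obtain i where i: "i < length ds" "peval (ds ! i) g xs = None"
      by (metis in_set_conv_nth)
    then have "stages (\<lambda>s. D (ds ! i) g (s # xs)) None"
      using D(2)[of "ds ! i" xs g] l by simp
    then have "D (ds ! i) g (s # xs) = 0" for s by (rule stages_None)
    then have "T g (s # xs) = 0" for s using i(1) by (auto simp: T_def)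
    moreover have "None \<in> set (map (\<lambda>d. peval d g xs) ds)"
      using i by (metis length_map nth_map nth_mem)
    then have "peval (Comp e ds) g xs = None" by (simp add: Let_def)
    ultimately show ?thesis using stages_const(2) by simp
  qed
  ultimately show ?case by blast
next
  case (PrimRec e d)
  show ?case
  proof (cases n)
    case 0
    then show ?thesis
      by (intro exI[of _ "\<lambda>g ys. 0"]) (auto intro: computable_const stages_const)
  next
    case (Suc m)
    obtain F where F: "computable (Suc m) F"
      "\<And>g xs. length xs = m \<Longrightarrow> stages (\<lambda>s. F g (s # xs)) (peval e g xs)"
      using PrimRec.IH(1) by blast
    obtain H where H: "computable (Suc (Suc (Suc m))) H"
      "\<And>g xs. length xs = Suc (Suc m) \<Longrightarrow> stages (\<lambda>s. H g (s # xs)) (peval d g xs)"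
      using PrimRec.IH(2) by blast
    \<comment> \<open>The value 0 is passed on, so one unfinished step leaves the whole recursion
      unfinished at this stage.\<close>
    define T where "T = (\<lambda>g ys. rec_nat (F g (ys ! 0 # tl (tl ys)))
      (\<lambda>k y. if y = 0 then 0 else H g (ys ! 0 # k # (y - 1) # tl (tl ys))) (tl ys ! 0))"
    have "computable (Suc (Suc m)) T"
      unfolding T_def
      by (intro computable_rec computable_if0 computable_const computable_comp[OF F(1)]
          computable_comp[OF H(1)] computable_args_intros computable_arg computable_pred) simp_all
    moreover have "stages (\<lambda>s. T g (s # xs)) (peval (PrimRec e d) g xs)" if "length xs = n" for g xs
    proof -
      obtain k zs where xs: "xs = k # zs" and l: "length zs = m"
        using \<open>length xs = n\<close> Suc by (auto simp: length_Suc_conv)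
      have "stages (\<lambda>s. rec_nat (F g (s # zs))
          (\<lambda>k y. if y = 0 then 0 else H g (s # k # (y - 1) # zs)) k)
        (rec_nat (peval e g zs)
          (\<lambda>m r. case r of None \<Rightarrow> None | Some y \<Rightarrow> peval d g (m # y # zs)) k)"
        (is "stages (\<lambda>s. ?t s k) (?p k)")
      proof (induction k)
        case 0
        show ?case using F(2)[OF l] by simp
      next
        case (Suc k)
        show ?case
        proof (cases "?p k")
          case None
          have "?t s k = 0" for s by (rule stages_None[OF Suc[unfolded None]])
          then show ?thesis using None stages_const(2) by simp
        next
          case (Some y)
          have Hs: "stages (\<lambda>s. H g (s # k # y # zs)) (peval d g (k # y # zs))"
            using H(2) l by simp
          have eq: "?t s k = Suc y" if "?t s k \<noteq> 0" for s
            using stages_sound[OF Suc, of s "?t s k - 1"] that Some by simp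
          obtain r where r: "\<forall>s\<ge>r. ?t s k = Suc y"
            using stages_limit[OF Suc[unfolded Some]] by blast
          have "\<exists>r. \<forall>s\<ge>r. ?t s (Suc k) = Suc z" if z: "peval d g (k # y # zs) = Some z" for z
          proof -
            obtain r' where "\<forall>s\<ge>r'. H g (s # k # y # zs) = Suc z"
              using stages_limit[OF Hs[unfolded z]] by blast
            then have "\<forall>s\<ge>max r r'. ?t s (Suc k) = Suc z" using r by simp
            then show ?thesis by blast
          qed
          moreover have "peval d g (k # y # zs) = Some z" if z: "?t s (Suc k) = Suc z" for s z
          proof -
            have "?t s k \<noteq> 0" using z by (auto split: if_splits)
            from eq[OF this] z show ?thesis using stages_sound[OF Hs] by simp
          qed
          ultimately show ?thesis using Some by (simp add: stages_def)
        qed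
      qed
      then show ?thesis by (simp add: T_def xs cong: if_cong)
    qed
    ultimately show ?thesis using Suc by blast
  qed
next
  case (Mu e)
  obtain F where F: "computable (Suc (Suc n)) F"
    "\<And>g xs. length xs = Suc n \<Longrightarrow> stages (\<lambda>s. F g (s # xs)) (peval e g xs)"
    using Mu.IH by blast
  \<comment> \<open>The approximation to the value at \<open>k\<close> is 0 if that value is still
    unknown and 1 if it is known to be 0. \<open>J\<close> stops at the first such \<open>k\<close>,
    or at the stage itself, which keeps the search total. Only a known zero yields a result.\<close>
  define J where "J = (\<lambda>g ys. LEAST k. ys ! 0 \<le> k \<or> F g (ys ! 0 # k # tl ys) \<le> 1)"
  define T where "T = (\<lambda>g ys. if F g (ys ! 0 # J g ys # tl ys) = 1 then Suc (J g ys) else 0)"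
  have J: "computable (Suc n) J"
    unfolding J_def
    by (intro computable_Least decidable_disj decidable_le computable_comp[OF F(1)]
        computable_args_intros computable_arg computable_const) auto
  have "computable (Suc n) T"
    unfolding T_def
    by (intro computable_if decidable_eq computable_comp[OF F(1)] computable_Suc J
        computable_args_intros computable_arg computable_const) simp
  moreover have "stages (\<lambda>s. T g (s # xs)) (peval (Mu e) g xs)" if l: "length xs = n" for g xs
  proof -
    let ?f = "\<lambda>k. peval e g (k # xs)"
    let ?halts = "\<lambda>k. ?f k = Some 0 \<and> (\<forall>m<k. \<exists>y. ?f m = Some (Suc y))"
    have Fk: "stages (\<lambda>s. F g (s # k # xs)) (?f k)" for k using F(2) l by simp
    have val: "peval (Mu e) g xs = Some k" if "?halts k" for k
    proof -
      have "(LEAST k. ?f k = Some 0) = k"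
      proof (rule Least_equality)
        show "?f k = Some 0" using that by blast
        show "k \<le> m" if m: "?f m = Some 0" for m
        proof (rule ccontr)
          assume "\<not> k \<le> m"
          then obtain y where "?f m = Some (Suc y)" using \<open>?halts k\<close> by (meson not_le)
          with m show False by simp
        qed
      qed
      moreover have "\<exists>k. ?halts k" using that by blast
      ultimately show ?thesis by (simp only: peval.simps if_True)
    qed
    have sound: "?halts y" if "T g (s # xs) = Suc y" for s y
    proof -
      have y: "J g (s # xs) = y" "F g (s # y # xs) = Suc 0"
        using that by (auto simp: T_def split: if_splits)
      \<comment> \<open>Below \<open>J\<close> the approximations exceed 1: these computations have
        halted with positive values, as \<open>Mu\<close> requires.\<close>
      have "\<exists>z. ?f m = Some (Suc z)" if "m < y" for m
      proof -
        have "\<not> F g (s # m # xs) \<le> 1"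
          using not_less_Least[of m "\<lambda>k. s \<le> k \<or> F g (s # k # xs) \<le> 1"] that y(1)
          by (simp add: J_def)
        then have "F g (s # m # xs) = Suc (Suc (F g (s # m # xs) - 2))" by simp
        then show ?thesis using stages_sound[OF Fk] by blast
      qed
      then show ?thesis using stages_sound[OF Fk y(2)] by blast
    qed
    have complete: "\<exists>r. \<forall>s\<ge>r. T g (s # xs) = Suc y" if "?halts y" for y
    proof -
      have "\<exists>r. \<forall>s\<ge>r. \<forall>k<y. \<not> F g (s # k # xs) \<le> 1"
      proof (rule uniform_limit_stage)
        fix k assume "k < y"
        then obtain z where z: "?f k = Some (Suc z)" using \<open>?halts y\<close> by blast
        obtain r where "\<forall>s\<ge>r. F g (s # k # xs) = Suc (Suc z)"
          using stages_limit[OF Fk[of k, unfolded z]] by blast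
        then have "\<forall>s\<ge>r. \<not> F g (s # k # xs) \<le> 1" by simp
        then show "\<exists>r. \<forall>s\<ge>r. \<not> F g (s # k # xs) \<le> 1" by blast
      qed
      then obtain r where r: "\<forall>s\<ge>r. \<forall>k<y. \<not> F g (s # k # xs) \<le> 1" by blast
      have "?f y = Some 0" using \<open>?halts y\<close> by blast
      from stages_limit[OF Fk[of y, unfolded this]]
      obtain r' where r': "\<forall>s\<ge>r'. F g (s # y # xs) = Suc 0" by blast
      \<comment> \<open>The stage must also be at least \<open>y\<close>, lest its own bound stop
        the search before the zero.\<close>
      have "T g (s # xs) = Suc y" if s: "s \<ge> max (max r r') y" for s
      proof -
        have "J g (s # xs) = y"
          unfolding J_def
          by (rule Least_equality) (use r r' s in \<open>auto simp: not_le[symmetric]\<close>)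
        then show ?thesis using r' s by (simp add: T_def)
      qed
      then show ?thesis by blast
    qed
    have halts: "?halts y" if "peval (Mu e) g xs = Some y" for y
    proof -
      have "\<exists>k. ?halts k"
      proof (rule ccontr)
        assume "\<not> ?thesis"
        then have "peval (Mu e) g xs = None" by (simp only: peval.simps if_False)
        with that show False by (simp only: option.distinct)
      qed
      then obtain k where k: "?halts k" by blast
      have "k = y" using val[OF k] that by (simp only: option.inject)
      with k show ?thesis by blast
    qed
    show ?thesis
      unfolding stages_def
    proof (intro conjI allI impI)
      show "peval (Mu e) g xs = Some y" if "T g (s # xs) = Suc y" for s y
        by (rule val[OF sound[OF that]])
      show "\<exists>r. \<forall>s\<ge>r. T g (s # xs) = Suc y" if "peval (Mu e) g xs = Some y" for y
        by (rule complete[OF halts[OF that]])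
    qed
  qed
  ultimately show ?case by blast
qed

section \<open>Substitution of a functional for the oracle\<close>

text \<open>The term put in the place of the argument of \<open>d\<close> is the identity, but undefined on argument
  lists of the wrong length, as \<open>Oracle\<close> is.\<close>

primrec subst_oracle :: "recf \<Rightarrow> recf \<Rightarrow> recf" where
  "subst_oracle d Zero = Zero"
| "subst_oracle d Succ = Succ"
| "subst_oracle d (Proj i) = Proj i"
| "subst_oracle d Oracle = Comp d [Comp (PrimRec Zero (Proj 0)) [Succ]]"
| "subst_oracle d (Comp e es) = Comp (subst_oracle d e) (map (subst_oracle d) es)"
| "subst_oracle d (PrimRec e e') = PrimRec (subst_oracle d e) (subst_oracle d e')"
| "subst_oracle d (Mu e) = Mu (subst_oracle d e)"

lemma peval_subst_oracle:
  assumes "\<And>k. peval d g [k] = Some (h k)"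
  shows "peval (subst_oracle d e) g xs = peval e h xs"
proof (induction e arbitrary: xs)
  case Oracle
  \<comment> \<open>A recursion that returns its counter is the predecessor; composed with
    \<open>Succ\<close> it is the identity on a single argument.\<close>
  have "rec_nat (Some 0) (\<lambda>m. case_option None (\<lambda>y. Some m)) (Suc k) = Some k" for k
    by (induction k) simp_all
  then show ?case by (auto simp: assms Let_def simp del: old.nat.simps split: list.split)
next
  case (Comp e es)
  have "map (\<lambda>d. peval d g xs) (map (subst_oracle d) es) = map (\<lambda>d. peval d h xs) es"
    using Comp.IH(2) by simp
  then show ?case by (simp only: subst_oracle.simps peval.simps Comp.IH(1))
next
  case (PrimRec e e')
  then show ?case by (auto split: list.split)
qed (auto split: list.split)

text \<open>Composition of functionals, by rewriting the program for \<open>\<Psi>\<close>. It is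
  applied where the first functional is total, as a Medvedev reduction is on
  \<open>R\<close>.\<close>

lemma partial_computable_substitute:
  assumes "partial_computable \<Phi>" "partial_computable \<Psi>"
  obtains \<Delta> where "partial_computable \<Delta>"
    "\<And>g h. (\<And>k. \<Phi> g k = Some (h k)) \<Longrightarrow> \<Delta> g = \<Psi> h"
proof -
  obtain d e where d: "\<And>g k. \<Phi> g k = peval d g [k]" and e: "\<And>g k. \<Psi> g k = peval e g [k]"
    using assms unfolding partial_computable_def by blast
  show ?thesis
  proof (rule that)
    show "partial_computable (\<lambda>g k. peval (subst_oracle d e) g [k])"
      unfolding partial_computable_def by blast
    show "(\<lambda>k. peval (subst_oracle d e) g [k]) = \<Psi> h" if "\<And>k. \<Phi> g k = Some (h k)" for g h
      using peval_subst_oracle[of d g h e] that d e by auto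
  qed
qed

section \<open>Functionals as searches and as limits of stages\<close>

lemma partial_computable_search:
  assumes "computable (Suc (Suc 0)) (\<lambda>g ys. t g (ys ! 0) (tl ys ! 0))"
  shows "partial_computable (\<lambda>g u. search (\<lambda>s. t g s u))"
proof -
  obtain e where "\<And>g xs. length xs = Suc 0 \<Longrightarrow> peval e g xs = search (\<lambda>s. t g s (xs ! 0))"
    using peval_search[of "Suc 0" "\<lambda>g s xs. t g s (xs ! 0)"] assms by auto
  then have "\<forall>g u. search (\<lambda>s. t g s u) = peval e g [u]" by simp
  then show ?thesis unfolding partial_computable_def by blast
qed

lemma partial_computable_stages:
  assumes "partial_computable \<Phi>"
  obtains T where "computable (Suc (Suc 0)) T" "\<And>g u. stages (\<lambda>s. T g [s, u]) (\<Phi> g u)"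
proof -
  obtain e where "\<And>g u. \<Phi> g u = peval e g [u]"
    using assms unfolding partial_computable_def by blast
  with normal_form[of "Suc 0" e] show ?thesis by (auto intro: that)
qed

lemma uniformly_computable_stages:
  assumes "uniformly_computable \<Gamma>"
  obtains T where "computable (Suc (Suc (Suc 0))) T"
    "\<And>v g u. stages (\<lambda>s. T g [s, v, u]) (\<Gamma> v g u)"
proof -
  obtain e where "\<And>v g u. \<Gamma> v g u = peval e g [v, u]"
    using assms unfolding uniformly_computable_def by blast
  with normal_form[of "Suc (Suc 0)" e] show ?thesis by (auto intro: that)
qed

lemma computable_relation_decidable:
  "computable_relation A \<longleftrightarrow> decidable (Suc (Suc 0)) (\<lambda>g xs. A (xs ! 0) (xs ! 1) g)"
proof -
  have "(\<forall>n v g. peval e g [n, v] = Some (if A n v g then 1 else 0)) \<longleftrightarrow>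
      (\<forall>g xs. length xs = Suc (Suc 0) \<longrightarrow>
        peval e g xs = Some (if A (xs ! 0) (xs ! 1) g then 1 else 0))" (is "?l \<longleftrightarrow> ?r") for e
  proof
    assume ?l
    then show ?r by (auto simp: length_Suc_conv)
  next
    assume r: ?r
    show ?l
    proof (intro allI)
      fix n v g
      show "peval e g [n, v] = Some (if A n v g then 1 else 0)"
        using r[rule_format, of "[n, v]" g] by simp
    qed
  qed
  then show ?thesis unfolding computable_relation_def decidable_def computable_def by simp
qed

section \<open>Walks and contents\<close>

lemma walk_short: "length \<tau> \<le> Suc 0 \<Longrightarrow> walk \<tau> = []"
  by (subst walk.simps) simp

lemma walk_map_Suc_Suc:
  "walk (map h [0..<Suc (Suc k)]) =
    walk (map h [0..<Suc k]) @ (if h k = Sharp then [h (Suc k)] else [])"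
proof -
  have "map h [0..<Suc (Suc k)] ! k = h k" "map h [0..<Suc (Suc k)] ! Suc k = h (Suc k)"
    by (simp_all del: upt_Suc)
  moreover have "butlast (map h [0..<Suc (Suc k)]) = map h [0..<Suc k]"
    by (simp add: butlast_append)
  ultimately show ?thesis by (subst walk.simps) (simp del: upt_Suc)
qed

lemma walk_map_Suc: "\<exists>zs. walk (map h [0..<Suc n]) = walk (map h [0..<n]) @ zs"
proof (cases n)
  case 0
  then show ?thesis by (simp add: walk_short)
next
  case (Suc k)
  then show ?thesis using walk_map_Suc_Suc[of h k] by metis
qed

lemma chain_le:
  assumes "\<And>n. \<exists>zs. \<sigma> (Suc n) = \<sigma> n @ zs" and "n \<le> m"
  shows "\<exists>zs. \<sigma> m = \<sigma> n @ zs"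
  using assms(2)
proof (induction m rule: dec_induct)
  case base
  show ?case by simp
next
  case (step m)
  then show ?case using assms(1)[of m] by auto
qed

text \<open>Any two strings of a chain agree where both are defined, so the description in
  \<open>union_seq\<close> is unique.\<close>

lemma union_seq_chain:
  assumes chain: "\<And>n. \<exists>zs. \<sigma> (Suc n) = \<sigma> n @ zs" and i: "i < length (\<sigma> n)"
  shows "union_seq \<sigma> i = Some (\<sigma> n ! i)"
proof -
  have "a = \<sigma> n ! i" if "i < length (\<sigma> m)" "a = \<sigma> m ! i" for a m
  proof (cases "n \<le> m")
    case True
    then show ?thesis using chain_le[of \<sigma>, OF chain True] that i by (auto simp: nth_append)
  next
    case False
    then have "m \<le> n" by simp
    then show ?thesis using chain_le[of \<sigma>, OF chain \<open>m \<le> n\<close>] that i by (auto simp: nth_append)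
  qed
  then have "(THE a. \<exists>n. i < length (\<sigma> n) \<and> a = \<sigma> n ! i) = \<sigma> n ! i"
    using i by (intro the_equality) blast+
  then show ?thesis using i unfolding union_seq_def by auto
qed

lemma union_seq_None: "(\<And>n. length (\<sigma> n) \<le> i) \<Longrightarrow> union_seq \<sigma> i = None"
  unfolding union_seq_def by (simp add: not_less)

lemma prefix_eq_take:
  assumes "\<And>i. i < length xs \<Longrightarrow> p i = Some (xs ! i)"
    and "m \<le> length xs \<or> p (length xs) = None"
  shows "prefix p m = take m xs"
proof -
  have "takeWhile (\<lambda>a. a \<noteq> None) (map p [0..<m]) = take (length xs) (map p [0..<m])"
    by (rule takeWhile_eq_take_P_nth) (use assms in auto)
  also have "\<dots> = map Some (take m xs)"
    by (rule nth_equalityI) (use assms(1) in auto)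
  finally show ?thesis by (simp add: prefix_def)
qed

lemma prefix_total:
  assumes "\<And>i. p i = Some (f i)"
  shows "prefix p m = map f [0..<m]"
  using prefix_eq_take[of "map f [0..<m]" p m] assms by simp

lemma prefix_Suc: "\<exists>zs. prefix p (Suc n) = prefix p n @ zs"
proof -
  have "\<exists>zs. takeWhile S (xs @ ys) = takeWhile S xs @ zs" for S and xs ys :: "'b list"
    by (metis append_Nil2 takeWhile_append takeWhile_eq_all_conv)
  then obtain zs where "takeWhile (\<lambda>a. a \<noteq> None) (map p [0..<n] @ [p n])
      = takeWhile (\<lambda>a. a \<noteq> None) (map p [0..<n]) @ zs" by blast
  then show ?thesis unfolding prefix_def by simp
qed

lemma content_prefix_Suc: "\<exists>zs. content (prefix p (Suc n)) = content (prefix p n) @ zs"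
  using prefix_Suc[of p n] by (auto simp: content_def)

lemma content_seq_total:
  assumes p: "\<And>i. p i = Some (x i)" and c: "\<And>m. content (map x [0..<m]) = map f [0..<c m]"
    and i: "i < c m"
  shows "content_seq p i = Some (f i)"
proof -
  have "content (prefix p m) = map f [0..<c m]"
    using prefix_total[OF p] c by simp
  then show ?thesis
    unfolding content_seq_def
    using union_seq_chain[of "\<lambda>m. content (prefix p m)", OF content_prefix_Suc, of i m] i by simp
qed

text \<open>Either some string has length at least \<open>m\<close>, or the lengths are bounded and
  a longest string is the whole union.\<close>

lemma prefix_union_seq:
  assumes chain: "\<And>n. \<exists>zs. \<sigma> (Suc n) = \<sigma> n @ zs"
  shows "\<exists>n. prefix (union_seq \<sigma>) m = take m (\<sigma> n)"
proof (cases "\<exists>n. m \<le> length (\<sigma> n)")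
  case True
  then obtain n where "m \<le> length (\<sigma> n)" by blast
  then show ?thesis
    by (intro exI[of _ n] prefix_eq_take union_seq_chain[of \<sigma>, OF chain]) auto
next
  case False
  then have "\<forall>n. length (\<sigma> n) < m" by (simp add: not_le)
  then have "\<exists>n. \<forall>k. length (\<sigma> k) \<le> length (\<sigma> n)"
    using ex_has_greatest_nat[of "\<lambda>_. True" undefined "\<lambda>n. length (\<sigma> n)" m] by simp
  then obtain n where n: "\<And>k. length (\<sigma> k) \<le> length (\<sigma> n)" by blast
  then have "union_seq \<sigma> (length (\<sigma> n)) = None" by (rule union_seq_None)
  then show ?thesis
    by (intro exI[of _ n] prefix_eq_take union_seq_chain[of \<sigma>, OF chain]) auto
qed

text \<open>The walk may be finite, so the two sides are compared through finite strings: the walk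
  of an initial segment is a prefix of \<open>walk_seq h\<close>, and every prefix of
  \<open>walk_seq h\<close> is an initial segment of such a walk. Deleting passes respects
  this.\<close>

lemma content_seq_walk_seq:
  "content_seq (walk_seq h) = union_seq (\<lambda>n. content (walk (map h [0..<n])))"
proof
  fix i
  let ?\<sigma> = "\<lambda>n. walk (map h [0..<n])"
  note chain = walk_map_Suc[of h]
  have content_chain: "\<exists>zs. content (?\<sigma> (Suc n)) = content (?\<sigma> n) @ zs" for n
    using chain[of n] by (auto simp: content_def simp del: upt_Suc)
  show "content_seq (walk_seq h) i = union_seq (\<lambda>n. content (?\<sigma> n)) i"
  proof (cases "\<exists>n. i < length (content (?\<sigma> n))")
    case True
    then obtain n where n: "i < length (content (?\<sigma> n))" by blast
    have "prefix (walk_seq h) (length (?\<sigma> n)) = ?\<sigma> n"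
      unfolding walk_seq_def
      using prefix_eq_take[of "?\<sigma> n" "union_seq ?\<sigma>" "length (?\<sigma> n)"]
        union_seq_chain[of ?\<sigma> _ n, OF chain] by simp
    then have "content_seq (walk_seq h) i = Some (content (?\<sigma> n) ! i)"
      unfolding content_seq_def
      using union_seq_chain[of "\<lambda>m. content (prefix (walk_seq h) m)", OF content_prefix_Suc,
          of i "length (?\<sigma> n)"] n by simp
    then show ?thesis
      using union_seq_chain[of "\<lambda>n. content (?\<sigma> n)", OF content_chain n] by simp
  next
    case False
    have "length (content (prefix (walk_seq h) m)) \<le> i" for m
    proof -
      obtain n where "prefix (walk_seq h) m = take m (?\<sigma> n)"
        using prefix_union_seq[of ?\<sigma> m, OF chain] unfolding walk_seq_def by blast
      then have "content (?\<sigma> n) = content (prefix (walk_seq h) m) @ content (drop m (?\<sigma> n))"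
        by (metis append_take_drop_id content_def filter_append)
      moreover have "length (content (?\<sigma> n)) \<le> i" using False by (simp add: not_less)
      ultimately show ?thesis by simp
    qed
    then have "content_seq (walk_seq h) i = None"
      unfolding content_seq_def by (rule union_seq_None)
    moreover have "union_seq (\<lambda>n. content (?\<sigma> n)) i = None"
      using False by (intro union_seq_None) (simp add: not_less)
    ultimately show ?thesis by simp
  qed
qed

lemma infinite_in_nums_iff:
  "infinite_in p (nums B) \<longleftrightarrow> (\<exists>f\<in>B. \<forall>i. p i = Some (Num (f i)))"
  unfolding infinite_in_def nums_def by auto

lemma disj_bowtie_subset: "disj_bowtie Q P \<subseteq> disj_Sigma02 Q P"
proof -
  have "infinite_in (content_seq (walk_seq g)) (nums Q)"
    if "infinite_in (walk_seq g) (nums Q)" for g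
  proof -
    obtain f where f: "f \<in> Q" "\<And>i. walk_seq g i = Some (Num (f i))"
      using \<open>infinite_in (walk_seq g) (nums Q)\<close> unfolding infinite_in_nums_iff by blast
    \<comment> \<open>A walk made of numbers has no passes, so the count of surviving entries is the
      identity.\<close>
    have "content_seq (walk_seq g) i = Some (Num (f i))" for i
      using content_seq_total[of "walk_seq g" "\<lambda>i. Num (f i)" "\<lambda>i. Num (f i)" id i "Suc i"] f(2)
      by (simp add: content_def filter_empty_conv filter_id_conv)
    then show ?thesis using f(1) unfolding infinite_in_nums_iff by blast
  qed
  then show ?thesis unfolding disj_bowtie_def disj_Sigma02_def by blast
qed

section \<open>Sequences of blocks\<close>

text \<open>A schedule for a sequence made of blocks \<open>x v, y, y, \<dots>, y, Sharp\<close>: the phase is \<open>2 * v\<close> at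
  the first entry of block \<open>v\<close> and \<open>2 * v + 1\<close> in the rest of it, and the block is closed at the
  first place \<open>k\<close> at which \<open>bad k v\<close> holds.\<close>

primrec phase :: "(nat \<Rightarrow> nat \<Rightarrow> bool) \<Rightarrow> nat \<Rightarrow> nat" where
  "phase bad 0 = 0"
| "phase bad (Suc k) =
    (if even (phase bad k) \<or> bad k (phase bad k div 2) then Suc (phase bad k) else phase bad k)"

text \<open>The filler \<open>y\<close> is indexed by the place in the whole sequence;
  \<open>tail_layout\<close> translates this into positions in the last block.\<close>

definition layout ::
    "(nat \<Rightarrow> nat \<Rightarrow> bool) \<Rightarrow> (nat \<Rightarrow> sym) \<Rightarrow> (nat \<Rightarrow> nat) \<Rightarrow> nat \<Rightarrow> sym" where
  "layout bad x y k =
    (if even (phase bad k) then x (phase bad k div 2)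
     else if bad k (phase bad k div 2) then Sharp else Num (y k))"

lemma phase_mono: "j \<le> k \<Longrightarrow> phase bad j \<le> phase bad k"
  by (rule lift_Suc_mono_le[of "phase bad"]) auto

text \<open>Induction over blocks: block \<open>v\<close> is entered once its predecessors have
  closed, and it cannot stay open, since a counterexample known at place \<open>b\<close> is still
  known at later places inside the block.\<close>

lemma phase_unbounded:
  assumes mono: "\<And>k k' v. bad k v \<Longrightarrow> k \<le> k' \<Longrightarrow> bad k' v"
    and ex: "\<And>w. w < v \<Longrightarrow> \<exists>k. bad k w"
  shows "\<exists>k. phase bad k = 2 * v"
  using ex
proof (induction v)
  case 0
  have "phase bad 0 = 2 * 0" by simp
  then show ?case by blast
next
  case (Suc v)
  then obtain k where k: "phase bad k = 2 * v" by (meson less_SucI)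
  obtain b where b: "bad b v" using Suc.prems by blast
  have step: "phase bad (Suc n) = (if bad n v then Suc (Suc (2 * v)) else Suc (2 * v))"
    if "phase bad n = Suc (2 * v)" for n using that by simp
  show ?case
  proof (rule ccontr)
    assume never: "\<not> ?thesis"
    then have never': "phase bad n \<noteq> Suc (Suc (2 * v))" for n by simp
    \<comment> \<open>If block \<open>v\<close> never closed, the phase would be constant from its
      second entry on, also at a place beyond \<open>b\<close>, where \<open>bad\<close> forces it
      to move.\<close>
    have stay: "phase bad (Suc k + i) = Suc (2 * v)" for i
    proof (induction i)
      case 0
      show ?case by (simp add: k)
    next
      case (Suc i)
      have "\<not> bad (Suc k + i) v"
      proof
        assume "bad (Suc k + i) v"
        then have "phase bad (Suc (Suc k + i)) = Suc (Suc (2 * v))"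
          using step[OF Suc] by (simp only: if_True)
        with never' show False by blast
      qed
      then show ?case using step[OF Suc] by (simp only: if_False add_Suc_right)
    qed
    have "bad (Suc k + b) v" using mono[OF b] by simp
    then have "phase bad (Suc (Suc k + b)) = 2 * Suc v" using step[OF stay[of b]] by simp
    with never show False by blast
  qed
qed

text \<open>The phase grows by at most one per place and cannot leave
  \<open>2 * v + 1\<close>.\<close>

lemma phase_bounded:
  assumes "\<And>k. \<not> bad k v"
  shows "phase bad k \<le> Suc (2 * v)"
proof (induction k)
  case (Suc k)
  have "phase bad k = Suc (2 * v) \<Longrightarrow> ?case" using assms by simp
  then show ?case using Suc by (auto simp: le_less)
qed simp

text \<open>As \<open>x\<close> avoids sharps, a sharp is written only where a block closes, and the
  next entry is the first of the following block. So each closed block adds one \<open>x\<close> to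
  the walk, while \<open>x 0\<close> follows no sharp and never enters it.\<close>

lemma walk_layout:
  assumes x: "\<And>v. x v \<noteq> Sharp"
  shows "walk (map (layout bad x y) [0..<Suc k]) = map x [1..<Suc (phase bad k div 2)]"
proof (induction k)
  case 0
  show ?case by (simp add: walk_short)
next
  case (Suc k)
  let ?w = "phase bad k"
  consider "even ?w" | "odd ?w" "bad k (?w div 2)" | "odd ?w" "\<not> bad k (?w div 2)" by blast
  then show ?case
  proof cases
    case 1
    then show ?thesis
      unfolding walk_map_Suc_Suc Suc using x by (simp add: layout_def del: upt_Suc)
  next
    case 2
    then have "phase bad (Suc k) = Suc ?w" "layout bad x y k = Sharp"
      "Suc ?w div 2 = Suc (?w div 2)" "even (Suc ?w)"
      by (auto simp: layout_def elim: oddE)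
    moreover from this have "layout bad x y (Suc k) = x (Suc (?w div 2))"
      by (simp add: layout_def del: phase.simps)
    ultimately show ?thesis
      unfolding walk_map_Suc_Suc Suc by (simp del: phase.simps)
  next
    case 3
    then show ?thesis
      unfolding walk_map_Suc_Suc Suc by (simp add: layout_def del: upt_Suc)
  qed
qed

lemma walk_seq_layout:
  assumes mono: "\<And>k k' v. bad k v \<Longrightarrow> k \<le> k' \<Longrightarrow> bad k' v"
    and ex: "\<And>v. \<exists>k. bad k v" and x: "\<And>v. x v \<noteq> Sharp"
  shows "walk_seq (layout bad x y) i = Some (x (Suc i))"
proof -
  obtain k where k: "phase bad k = 2 * Suc i"
    using phase_unbounded[of bad "Suc i"] mono ex by blast
  have "walk (map (layout bad x y) [0..<Suc k]) = map x [1..<Suc (Suc i)]"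
    using walk_layout[OF x] k by simp
  then show ?thesis
    unfolding walk_seq_def
    using union_seq_chain[of "\<lambda>n. walk (map (layout bad x y) [0..<n])" i "Suc k", OF walk_map_Suc]
    by (simp del: upt_Suc)
qed

text \<open>The blocks before \<open>v\<close> close and block \<open>v\<close> does not, so the
  tail is block \<open>v\<close>: \<open>shift\<close> removes its first entry \<open>x v\<close>
  and the filler remains. The least place of phase \<open>2 * v + 1\<close> is the second entry of
  the block, where \<open>f\<close> starts.\<close>

lemma tail_layout:
  assumes mono: "\<And>k k' v. bad k v \<Longrightarrow> k \<le> k' \<Longrightarrow> bad k' v"
    and ex: "\<And>w. w < v \<Longrightarrow> \<exists>k. bad k w" and good: "\<And>k. \<not> bad k v"
    and x: "\<And>v. x v \<noteq> Sharp"
    and y: "\<And>k. phase bad k = Suc (2 * v) \<Longrightarrow>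
      y k = f (k - (LEAST j. phase bad j = Suc (2 * v)))"
  shows "finite {k. layout bad x y k = Sharp}"
    and "shift (tail (layout bad x y)) = (\<lambda>i. Num (f i))"
proof -
  let ?h = "layout bad x y"
  obtain k where k: "phase bad k = 2 * v" using phase_unbounded[of bad v] mono ex by blast
  have stay: "phase bad (Suc k + i) = Suc (2 * v)" for i
  proof (induction i)
    case 0
    show ?case by (simp add: k)
  next
    case (Suc i)
    then show ?case using good by simp
  qed
  have least: "(LEAST j. phase bad j = Suc (2 * v)) = Suc k"
  proof (rule Least_equality)
    show "phase bad (Suc k) = Suc (2 * v)" using stay[of 0] by simp
    show "Suc k \<le> j" if "phase bad j = Suc (2 * v)" for j
      using phase_mono[of j k bad] that k by (metis Suc_n_not_le_n not_less_eq_eq)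
  qed
  have rest: "?h (Suc k + i) = Num (f i)" for i
    using stay[of i] good y[OF stay[of i]] least by (simp add: layout_def del: phase.simps)
  have first: "?h k \<noteq> Sharp" using x by (simp add: layout_def k)
  have no_Sharp: "?h j \<noteq> Sharp" if "j \<ge> k" for j
    using rest[of "j - Suc k"] first that by (cases "j = k") auto
  then have "{j. ?h j = Sharp} \<subseteq> {..<k}" by (auto simp: not_le[symmetric])
  then show "finite {k. ?h k = Sharp}" by (rule finite_subset) simp
  have "(LEAST n. \<forall>j\<ge>n. ?h j \<noteq> Sharp) = k"
  proof (rule Least_equality)
    show "\<forall>j\<ge>k. ?h j \<noteq> Sharp" using no_Sharp by blast
    show "k \<le> n" if n: "\<forall>j\<ge>n. ?h j \<noteq> Sharp" for n
    proof (rule ccontr)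
      assume "\<not> k \<le> n"
      \<comment> \<open>An even phase at place \<open>Suc l\<close> can only come from closing a
        block at \<open>l\<close>. So the entry before block \<open>v\<close> is a sharp, and the
        tail cannot start earlier.\<close>
      then obtain l where l: "k = Suc l" "n \<le> l" by (cases k) auto
      have "?h l = Sharp"
      proof (cases "even (phase bad l)")
        case True
        then have "phase bad k = Suc (phase bad l)" by (simp add: l)
        with True k show ?thesis by (metis dvd_triv_left even_Suc)
      next
        case False
        then have "bad l (phase bad l div 2)"
          using k by (auto simp: l split: if_splits)
        with False show ?thesis by (simp add: layout_def)
      qed
      with n l show False by blast
    qed
  qed
  then show "shift (tail ?h) = (\<lambda>i. Num (f i))"
    using rest by (simp add: shift_def tail_def)
qed

section \<open>Computability of the block sequence\<close>

lemma decidable_even: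
  assumes "computable n a"
  shows "decidable n (\<lambda>g xs. even (a g xs))"
proof -
  have "computable n (\<lambda>g xs. rec_nat 0 (\<lambda>m y. 1 - y) (a g xs))"
    by (intro computable_rec assms computable_intros) simp
  moreover have "rec_nat 0 (\<lambda>m y. 1 - y) k = k mod 2" for k :: nat
    by (induction k) (auto simp: mod_Suc)
  ultimately show ?thesis
    using decidable_eq_0[of n "\<lambda>g xs. a g xs mod 2"] by (simp add: even_iff_mod_2_eq_zero)
qed

lemma computable_div_2:
  assumes "computable n a"
  shows "computable n (\<lambda>g xs. a g xs div 2)"
proof -
  have "computable n (\<lambda>g xs. rec_nat 0 (\<lambda>m y. if even m then y else Suc y) (a g xs))"
    by (intro computable_rec assms decidable_even computable_intros) simp_all
  moreover have "rec_nat 0 (\<lambda>m y. if even m then y else Suc y) k = k div 2" for k :: nat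
    by (induction k) auto
  ultimately show ?thesis by simp
qed

lemma computable_phase:
  assumes bad: "\<And>n a b. computable n a \<Longrightarrow> computable n b \<Longrightarrow>
      decidable n (\<lambda>g xs. bad g (a g xs) (b g xs))"
    and a: "computable n a"
  shows "computable n (\<lambda>g xs. phase (bad g) (a g xs))"
proof -
  have "computable n (\<lambda>g xs. rec_nat 0
      (\<lambda>k w. if even w \<or> bad g k (w div 2) then Suc w else w) (a g xs))"
    by (intro computable_rec a bad decidable_even computable_div_2 computable_intros) simp_all
  moreover have "rec_nat 0 (\<lambda>k w. if even w \<or> bad g k (w div 2) then Suc w else w) k
      = phase (bad g) k" for g k
    by (induction k) simp_all
  ultimately show ?thesis by simp
qed

text \<open>Of a junk entry it only matters that it codes a number, that is, that it is at least
  2.\<close>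

lemma search_Some_ge:
  assumes "\<exists>s. t s \<noteq> 0" "\<And>s. t s \<noteq> 0 \<Longrightarrow> Suc m \<le> t s"
  shows "\<exists>y. search t = Some (y + m)"
proof -
  have "Suc m \<le> t (LEAST s. t s \<noteq> 0)" using assms(2)[OF LeastI_ex[OF assms(1)]] .
  then have "search t = Some (t (LEAST s. t s \<noteq> 0) - 1 - m + m)"
    using assms(1) unfolding search_def by simp
  then show ?thesis by blast
qed

text \<open>\<open>X\<close> supplies the first entries of the blocks in coded form. The two
  conclusions treat the case that every block closes and the case that \<open>v\<close> is the first
  block that does not; in the latter \<open>X\<close> is consulted only up to block \<open>v\<close>
  and may diverge beyond. The clause on passes serves the variant of the disjunction without
  them.\<close>

lemma block_functional:
  assumes "computable_relation A" "uniformly_computable \<Gamma>" "partial_computable X"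
  obtains \<Phi> where "partial_computable \<Phi>"
    "\<forall>g x. (\<forall>v. \<exists>n. \<not> A n v g) \<longrightarrow> (\<forall>v. X g v = Some (code (x v)) \<and> x v \<noteq> Sharp) \<longrightarrow>
      (\<exists>h. (\<forall>k. \<Phi> g k = Some (code (h k))) \<and> (\<forall>i. walk_seq h i = Some (x (Suc i))) \<and>
        ((\<forall>v. x v \<noteq> Pass) \<longrightarrow> (\<forall>k. h k \<noteq> Pass)))"
    "\<forall>g x v f. (\<forall>w<v. \<exists>n. \<not> A n w g) \<longrightarrow> (\<forall>n. A n v g) \<longrightarrow>
      (\<forall>w\<le>v. X g w = Some (code (x w))) \<longrightarrow> (\<forall>w. x w \<noteq> Sharp) \<longrightarrow>
      (\<forall>u. \<Gamma> v g u = Some (f u)) \<longrightarrow>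
      (\<exists>h. (\<forall>k. \<Phi> g k = Some (code (h k))) \<and> finite {k. h k = Sharp} \<and>
        shift (tail h) = (\<lambda>i. Num (f i)) \<and> ((\<forall>v. x v \<noteq> Pass) \<longrightarrow> (\<forall>k. h k \<noteq> Pass)))"
proof -
  obtain TG where TG: "computable (Suc (Suc (Suc 0))) TG"
    "\<And>v g u. stages (\<lambda>s. TG g [s, v, u]) (\<Gamma> v g u)"
    using uniformly_computable_stages[OF assms(2)] by blast
  obtain TX where TX: "computable (Suc (Suc 0)) TX" "\<And>g u. stages (\<lambda>s. TX g [s, u]) (X g u)"
    using partial_computable_stages[OF assms(3)] by blast
  \<comment> \<open>Counterexamples are sought up to \<open>k\<close>, which makes
    \<open>bad\<close> decidable and monotone in \<open>k\<close>.\<close>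
  define bad where "bad g k v \<longleftrightarrow> \<not> (\<forall>n<Suc k. A n v g)" for g k v
  have bad_mono: "bad g k v \<Longrightarrow> k \<le> k' \<Longrightarrow> bad g k' v" for g k k' v
    unfolding bad_def by (meson less_Suc_eq_le order_trans)
  have A: "decidable n (\<lambda>g xs. A (a g xs) (b g xs) g)"
    if "computable n a" "computable n b" for n a b
  proof -
    have "computable n (\<lambda>g xs. if A ([a g xs, b g xs] ! 0) ([a g xs, b g xs] ! 1) g then 1 else 0)"
      using computable_comp[OF assms(1)[unfolded computable_relation_decidable decidable_def],
          of n "\<lambda>g xs. [a g xs, b g xs]"] that computable_args_Cons computable_args_Nil by blast
    then show ?thesis by (simp add: decidable_def)
  qed
  have bad: "decidable n (\<lambda>g xs. bad g (a g xs) (b g xs))"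
    if "computable n a" "computable n b" for n a b
    unfolding bad_def
    by (intro A computable_intros computable_comp[OF that(1)] computable_comp[OF that(2)]) simp_all
  define w where "w g k = phase (bad g) k" for g k
  have w: "computable n (\<lambda>g xs. w g (a g xs))" if "computable n a" for n a
    unfolding w_def by (rule computable_phase[OF _ that]) (rule bad)
  \<comment> \<open>In an odd phase, this is the position of place \<open>k\<close> in its block,
    counted from the second entry.\<close>
  define u where "u g k = k - (LEAST j. w g j = w g k)" for g k
  have u: "computable n (\<lambda>g xs. u g (a g xs))" if "computable n a" for n a
    unfolding u_def
    by (intro that computable_Least w computable_intros computable_comp[OF that]) auto
  \<comment> \<open>Values are successors of codes: 1 is a sharp, 3 is \<open>Num 0\<close>, and
    adding 2 to the marked value of \<open>\<Gamma>\<close> codes it as a number. For a filler, the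
    computation of \<open>\<Gamma>\<close> races against the discovery of a counterexample at stage
    \<open>s\<close>; \<open>Num 0\<close> is written if the counterexample wins.\<close>
  define t where "t g s k =
    (if even (w g k) then TX g [s, w g k div 2]
     else if bad g k (w g k div 2) then 1
     else if TG g [s, w g k div 2, u g k] = 0 then (if bad g s (w g k div 2) then 3 else 0)
     else TG g [s, w g k div 2, u g k] + 2)" for g s k
  define \<Phi> where "\<Phi> = (\<lambda>g k. search (\<lambda>s. t g s k))"
  have "computable (Suc (Suc 0)) (\<lambda>g ys. t g (ys ! 0) (tl ys ! 0))"
    unfolding t_def
    by (intro decidable_even computable_div_2 bad w u computable_comp[OF TX(1)]
        computable_comp[OF TG(1)] computable_intros) simp_all
  then have "partial_computable \<Phi>" unfolding \<Phi>_def by (rule partial_computable_search)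
  have even_w: "\<Phi> g k = Some c" if "even (w g k)" "X g (w g k div 2) = Some c" for g k c
    unfolding \<Phi>_def
  proof (rule search_Some)
    note st = TX(2)[of g "w g k div 2", unfolded that(2)]
    obtain s where "TX g [s, w g k div 2] = Suc c" using st by (rule stages_halts)
    then have "t g s k \<noteq> 0" using that(1) by (simp add: t_def)
    then show "\<exists>s. t g s k \<noteq> 0" by blast
    show "t g s k = Suc c" if "t g s k \<noteq> 0" for s
      using stages_sound[OF st, of s "TX g [s, w g k div 2] - 1"] that \<open>even (w g k)\<close>
      by (simp add: t_def)
  qed
  have sharp_w: "\<Phi> g k = Some 0" if "odd (w g k)" "bad g k (w g k div 2)" for g k
    unfolding \<Phi>_def by (rule search_Some) (use that in \<open>simp_all add: t_def\<close>)
  \<comment> \<open>In a block that will close, one side of the race ends the search, and either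
    outcome codes a number.\<close>
  have dying_w: "\<exists>y. \<Phi> g k = Some (y + 2)"
    if "odd (w g k)" "\<not> bad g k (w g k div 2)" "\<exists>n. \<not> A n (w g k div 2) g" for g k
    unfolding \<Phi>_def
  proof (rule search_Some_ge)
    from that(3) obtain n where "\<not> A n (w g k div 2) g" by blast
    then have "bad g n (w g k div 2)" unfolding bad_def by blast
    then have "t g n k \<noteq> 0" using that by (simp add: t_def)
    then show "\<exists>s. t g s k \<noteq> 0" by blast
    show "Suc 2 \<le> t g s k" if "t g s k \<noteq> 0" for s
      using that \<open>odd (w g k)\<close> \<open>\<not> bad g k (w g k div 2)\<close> by (auto simp: t_def split: if_splits)
  qed
  have final_w: "\<Phi> g k = Some (z + 2)"
    if "odd (w g k)" "\<And>n. A n (w g k div 2) g" "\<Gamma> (w g k div 2) g (u g k) = Some z" for g k z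
    unfolding \<Phi>_def
  proof (rule search_Some)
    have good: "\<not> bad g n (w g k div 2)" for n using that(2) unfolding bad_def by blast
    note st = TG(2)[where v = "w g k div 2" and g = g and u = "u g k", unfolded that(3)]
    obtain s where "TG g [s, w g k div 2, u g k] = Suc z" using st by (rule stages_halts)
    then have "t g s k \<noteq> 0" using that(1) good by (simp add: t_def)
    then show "\<exists>s. t g s k \<noteq> 0" by blast
    show "t g s k = Suc (z + 2)" if "t g s k \<noteq> 0" for s
      using stages_sound[OF st, of s "TG g [s, w g k div 2, u g k] - 1"] that \<open>odd (w g k)\<close> good
      by (auto simp: t_def split: if_splits)
  qed
  \<comment> \<open>The fillers are read back from \<open>\<Phi>\<close>, so it need not be known
    which side won the race.\<close>
  define h where "h g x = layout (bad g) x (\<lambda>k. the (\<Phi> g k) - 2)" for g x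
  have h: "\<Phi> g k = Some (code (h g x k))"
    if "X g (w g k div 2) = Some (code (x (w g k div 2)))"
      and "odd (w g k) \<Longrightarrow> \<not> bad g k (w g k div 2) \<Longrightarrow> \<exists>y. \<Phi> g k = Some (y + 2)" for g x k
    using even_w[OF _ that(1)] sharp_w[of g k] that(2)
    by (auto simp: h_def layout_def w_def[symmetric])
  have h_Pass: "(\<forall>v. x v \<noteq> Pass) \<longrightarrow> (\<forall>k. h g x k \<noteq> Pass)" for g x
    by (simp add: h_def layout_def)
  show ?thesis
  proof (rule that[OF \<open>partial_computable \<Phi>\<close>]; intro allI impI)
    fix g x
    assume "\<forall>v. \<exists>n. \<not> A n v g" "\<forall>v. X g v = Some (code (x v)) \<and> x v \<noteq> Sharp"
    then have fail: "\<And>v. \<exists>n. \<not> A n v g" and X: "\<And>v. X g v = Some (code (x v))"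
      and x: "\<And>v. x v \<noteq> Sharp" by auto
    have ex: "\<exists>k. bad g k v" for v using fail[of v] unfolding bad_def by blast
    have "walk_seq (h g x) i = Some (x (Suc i))" for i
      unfolding h_def by (rule walk_seq_layout) (use bad_mono ex x in blast)+
    moreover have "\<Phi> g k = Some (code (h g x k))" for k
      by (rule h[of g k x, OF X dying_w[OF _ _ fail]])
    ultimately show "\<exists>h. (\<forall>k. \<Phi> g k = Some (code (h k))) \<and>
        (\<forall>i. walk_seq h i = Some (x (Suc i))) \<and> ((\<forall>v. x v \<noteq> Pass) \<longrightarrow> (\<forall>k. h k \<noteq> Pass))"
      using h_Pass by blast
  next
    fix g x v f
    assume *: "\<forall>w<v. \<exists>n. \<not> A n w g" "\<forall>n. A n v g" "\<forall>w\<le>v. X g w = Some (code (x w))"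
      "\<forall>w. x w \<noteq> Sharp" "\<forall>u. \<Gamma> v g u = Some (f u)"
    note fail = *(1)[rule_format] and A = *(2)[rule_format] and X = *(3)[rule_format]
      and x = *(4)[rule_format] and \<Gamma> = *(5)[rule_format]
    have ex: "\<exists>k. bad g k w" if "w < v" for w using fail[OF that] unfolding bad_def by blast
    have good: "\<not> bad g k v" for k using A unfolding bad_def by blast
    \<comment> \<open>The phase never passes block \<open>v\<close>, so \<open>X\<close> is
      consulted only up to \<open>v\<close>.\<close>
    have le: "w g k \<le> Suc (2 * v)" for k unfolding w_def using phase_bounded good by blast
    have \<Phi>_final: "\<Phi> g k = Some (f (u g k) + 2)" if "w g k = Suc (2 * v)" for k
      by (rule final_w) (simp_all add: that A \<Gamma>)
    have "\<Phi> g k = Some (code (h g x k))" for k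
    proof (rule h)
      show "X g (w g k div 2) = Some (code (x (w g k div 2)))" using X le[of k] by simp
      show "\<exists>y. \<Phi> g k = Some (y + 2)" if "odd (w g k)" "\<not> bad g k (w g k div 2)"
      proof (cases "w g k = Suc (2 * v)")
        case True
        then show ?thesis using \<Phi>_final by blast
      next
        case False
        then have "w g k div 2 < v" using le[of k] that(1) by (auto elim!: oddE)
        then show ?thesis using dying_w that fail by blast
      qed
    qed
    moreover have "finite {k. h g x k = Sharp}" "shift (tail (h g x)) = (\<lambda>i. Num (f i))"
    proof -
      have y: "the (\<Phi> g k) - 2 = f (k - (LEAST j. phase (bad g) j = Suc (2 * v)))"
        if "phase (bad g) k = Suc (2 * v)" for k
        using \<Phi>_final[of k] that by (simp add: w_def u_def)
      show "finite {k. h g x k = Sharp}"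
        unfolding h_def by (rule tail_layout(1)[of "bad g" v]) (fact bad_mono ex good x y)+
      show "shift (tail (h g x)) = (\<lambda>i. Num (f i))"
        unfolding h_def by (rule tail_layout(2)[of "bad g" v]) (fact bad_mono ex good x y)+
    qed
    ultimately show "\<exists>h. (\<forall>k. \<Phi> g k = Some (code (h k))) \<and> finite {k. h k = Sharp} \<and>
        shift (tail h) = (\<lambda>i. Num (f i)) \<and> ((\<forall>v. x v \<noteq> Pass) \<longrightarrow> (\<forall>k. h k \<noteq> Pass))"
      using h_Pass by blast
  qed
qed

section \<open>The implications\<close>

lemma b_plus_imp_bowtie:
  assumes "cond_b_plus P Q R"
  shows "disj_bowtie Q P \<le>\<^sub>M R"
proof -
  obtain \<theta> \<Gamma> \<Delta> where \<theta>: "Pi01 \<theta>" and \<Gamma>: "uniformly_computable \<Gamma>"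
    and \<Delta>: "partial_computable \<Delta>"
    and inP: "\<And>g v. g \<in> R \<Longrightarrow> \<theta> v g \<Longrightarrow> infinite_in (\<Gamma> v g) P"
    and def\<Delta>: "\<And>g v. g \<in> R \<Longrightarrow> \<not> \<theta> v g \<Longrightarrow> \<Delta> g v \<noteq> None"
    and inQ: "\<And>g. g \<in> R \<Longrightarrow> \<not> (\<exists>v. \<theta> v g) \<Longrightarrow> infinite_in (\<Delta> g) Q"
  proof -
    obtain \<theta> \<Gamma> \<Delta> where *: "Pi01 \<theta>" "uniformly_computable \<Gamma>" "partial_computable \<Delta>"
      "\<forall>g\<in>R. \<forall>v. \<theta> v g \<longrightarrow> (\<forall>u. \<Gamma> v g u \<noteq> None) \<and> infinite_in (\<Gamma> v g) P"
      "\<forall>g\<in>R. \<forall>v. \<not> \<theta> v g \<longrightarrow>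
        (\<forall>u\<le>v. \<Delta> g u \<noteq> None) \<and> cylinder (prefix (\<Delta> g) (v + 1)) \<inter> Q \<noteq> {}"
      "\<forall>g\<in>R. \<not> (\<exists>v. \<theta> v g) \<longrightarrow> (\<forall>u. \<Delta> g u \<noteq> None) \<and> infinite_in (\<Delta> g) Q"
      using assms unfolding cond_b_plus_def by (elim exE conjE)
    show ?thesis by (rule that[OF *(1-3)]) (use *(4-6) in auto)
  qed
  obtain A where A: "computable_relation A" and \<theta>_A: "\<And>v g. \<theta> v g \<longleftrightarrow> (\<forall>n. A n v g)"
    using \<theta> unfolding Pi01_def by blast
  obtain T where T: "computable (Suc (Suc 0)) T" "\<And>g u. stages (\<lambda>s. T g [s, u]) (\<Delta> g u)"
    using partial_computable_stages[OF \<Delta>] by blast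
  \<comment> \<open>\<open>x 0\<close> does not enter the walk, so it is the dummy
    \<open>Num 0\<close>, with code 2 and marked value 3; the values of \<open>\<Delta>\<close> are
    shifted by one.\<close>
  define t where "t g s v = (if v = 0 then 3 else if T g [s, v - 1] = 0 then 0
    else T g [s, v - 1] + 2)" for g s v
  define X where "X = (\<lambda>g v. search (\<lambda>s. t g s v))"
  have "computable (Suc (Suc 0)) (\<lambda>g ys. t g (ys ! 0) (tl ys ! 0))"
    unfolding t_def by (intro computable_comp[OF T(1)] computable_intros) simp_all
  then have X: "partial_computable X" unfolding X_def by (rule partial_computable_search)
  have X_0: "X g 0 = Some 2" for g
    unfolding X_def by (rule search_Some) (simp_all add: t_def)
  have X_Suc: "X g (Suc v) = Some (z + 2)" if "\<Delta> g v = Some z" for g v z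
    unfolding X_def
  proof (rule search_Some)
    note st = T(2)[of g v, unfolded that]
    obtain s where "T g [s, v] = Suc z" using st by (rule stages_halts)
    then have "t g s (Suc v) \<noteq> 0" by (simp add: t_def)
    then show "\<exists>s. t g s (Suc v) \<noteq> 0" by blast
    show "t g s (Suc v) = Suc (z + 2)" if "t g s (Suc v) \<noteq> 0" for s
      using stages_sound[OF st, of s "T g [s, v] - 1"] that by (auto simp: t_def split: if_splits)
  qed
  \<comment> \<open>Where \<open>\<Delta>\<close> diverges the number is arbitrary, but it is a
    number, so \<open>x\<close> avoids sharps and passes everywhere.\<close>
  define x where "x g v = (if v = 0 then Num 0 else Num (the (\<Delta> g (v - 1))))" for g v
  have x: "x g v \<noteq> Sharp" "x g v \<noteq> Pass" for g v by (simp_all add: x_def)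
  have X_x: "X g v = Some (code (x g v))" if "\<And>w. w < v \<Longrightarrow> \<Delta> g w \<noteq> None" for g v
  proof (cases v)
    case 0
    then show ?thesis by (simp add: X_0 x_def)
  next
    case (Suc w)
    then obtain z where "\<Delta> g w = Some z" using \<open>\<And>w. w < v \<Longrightarrow> \<Delta> g w \<noteq> None\<close> by blast
    with X_Suc Suc show ?thesis by (simp add: x_def)
  qed
  obtain \<Phi> where \<Phi>: "partial_computable \<Phi>"
    and \<Phi>1: "\<forall>g x. (\<forall>v. \<exists>n. \<not> A n v g) \<longrightarrow> (\<forall>v. X g v = Some (code (x v)) \<and> x v \<noteq> Sharp) \<longrightarrow>
      (\<exists>h. (\<forall>k. \<Phi> g k = Some (code (h k))) \<and> (\<forall>i. walk_seq h i = Some (x (Suc i))) \<and>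
        ((\<forall>v. x v \<noteq> Pass) \<longrightarrow> (\<forall>k. h k \<noteq> Pass)))"
    and \<Phi>2: "\<forall>g x v f. (\<forall>w<v. \<exists>n. \<not> A n w g) \<longrightarrow> (\<forall>n. A n v g) \<longrightarrow>
      (\<forall>w\<le>v. X g w = Some (code (x w))) \<longrightarrow> (\<forall>w. x w \<noteq> Sharp) \<longrightarrow>
      (\<forall>u. \<Gamma> v g u = Some (f u)) \<longrightarrow>
      (\<exists>h. (\<forall>k. \<Phi> g k = Some (code (h k))) \<and> finite {k. h k = Sharp} \<and>
        shift (tail h) = (\<lambda>i. Num (f i)) \<and> ((\<forall>v. x v \<noteq> Pass) \<longrightarrow> (\<forall>k. h k \<noteq> Pass)))"
    by (rule block_functional[OF A \<Gamma> X])
  have "infinite_in (\<Phi> g) (disj_bowtie Q P)" if g: "g \<in> R" for g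
  proof -
    have "\<exists>h. (\<forall>k. \<Phi> g k = Some (code (h k))) \<and> (\<forall>k. h k \<noteq> Pass) \<and>
        (infinite_in (walk_seq h) (nums Q) \<or>
          finite {k. h k = Sharp} \<and> shift (tail h) \<in> nums P)"
    proof (cases "\<exists>v. \<theta> v g")
      case True
      \<comment> \<open>Below the least \<open>v\<close> every block closes, and
        \<open>\<not>\<theta>\<close> there also makes \<open>\<Delta>\<close> converge, so
        \<open>X\<close> is defined up to \<open>v\<close>.\<close>
      define v where "v = (LEAST v. \<theta> v g)"
      have v: "\<theta> v g" "\<And>w. w < v \<Longrightarrow> \<not> \<theta> w g"
        using LeastI_ex[OF True] not_less_Least unfolding v_def by blast+
      obtain f where f: "f \<in> P" "\<And>u. \<Gamma> v g u = Some (f u)"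
        using inP[OF g v(1)] unfolding infinite_in_def by blast
      have "\<exists>h. (\<forall>k. \<Phi> g k = Some (code (h k))) \<and> finite {k. h k = Sharp} \<and>
          shift (tail h) = (\<lambda>i. Num (f i)) \<and> ((\<forall>v. x g v \<noteq> Pass) \<longrightarrow> (\<forall>k. h k \<noteq> Pass))"
        by (rule \<Phi>2[rule_format, of v g "x g" f]) (use v \<theta>_A f(2) x X_x def\<Delta> g in auto)
      then show ?thesis using x(2) f(1) unfolding nums_def by blast
    next
      case False
      have def: "\<Delta> g w \<noteq> None" for w using False def\<Delta> g by blast
      have "\<exists>h. (\<forall>k. \<Phi> g k = Some (code (h k))) \<and> (\<forall>i. walk_seq h i = Some (x g (Suc i))) \<and>
          ((\<forall>v. x g v \<noteq> Pass) \<longrightarrow> (\<forall>k. h k \<noteq> Pass))"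
        by (rule \<Phi>1[rule_format, of g "x g"]) (use False \<theta>_A x X_x def in blast)+
      then obtain h where h: "\<forall>k. \<Phi> g k = Some (code (h k))" "\<forall>k. h k \<noteq> Pass"
        "\<And>i. walk_seq h i = Some (x g (Suc i))" using x(2) by blast
      obtain f where f: "f \<in> Q" "\<And>u. \<Delta> g u = Some (f u)"
        using inQ[OF g False] unfolding infinite_in_def by blast
      have "walk_seq h i = Some (Num (f i))" for i using h(3) f(2) by (simp add: x_def)
      then have "infinite_in (walk_seq h) (nums Q)"
        unfolding infinite_in_nums_iff using f(1) by blast
      with h show ?thesis by blast
    qed
    then obtain h where h: "\<forall>k. \<Phi> g k = Some (code (h k))" and "\<forall>k. h k \<noteq> Pass"
      "infinite_in (walk_seq h) (nums Q) \<or>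
        finite {k. h k = Sharp} \<and> shift (tail h) \<in> nums P" by blast
    then have "code \<circ> h \<in> disj_bowtie Q P" unfolding disj_bowtie_def by blast
    with h show ?thesis unfolding infinite_in_def by (intro bexI[of _ "code \<circ> h"]) auto
  qed
  with \<Phi> show ?thesis unfolding medvedev_le_def by blast
qed

lemma b_minus_imp_Sigma02:
  assumes "cond_b_minus P Q R"
  shows "disj_Sigma02 Q P \<le>\<^sub>M R"
proof -
  obtain \<theta> \<Gamma> \<Delta> where \<theta>: "Pi01 \<theta>" and \<Gamma>: "uniformly_computable \<Gamma>"
    and \<Delta>: "partial_computable \<Delta>"
    and inP: "\<And>g v. g \<in> R \<Longrightarrow> \<theta> v g \<Longrightarrow> infinite_in (\<Gamma> v g) P"
    and inQ: "\<And>g. g \<in> R \<Longrightarrow> \<not> (\<exists>v. \<theta> v g) \<Longrightarrow> infinite_in (\<Delta> g) Q"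
  proof -
    obtain \<theta> \<Gamma> \<Delta> where *: "Pi01 \<theta>" "uniformly_computable \<Gamma>" "partial_computable \<Delta>"
      "\<forall>g\<in>R. \<forall>v. \<theta> v g \<longrightarrow> (\<forall>u. \<Gamma> v g u \<noteq> None) \<and> infinite_in (\<Gamma> v g) P"
      "\<forall>g\<in>R. \<not> (\<exists>v. \<theta> v g) \<longrightarrow> (\<forall>u. \<Delta> g u \<noteq> None) \<and> infinite_in (\<Delta> g) Q"
      using assms unfolding cond_b_minus_def by (elim exE conjE)
    show ?thesis by (rule that[OF *(1-3)]) (use *(4-5) in auto)
  qed
  obtain A where A: "computable_relation A" and \<theta>_A: "\<And>v g. \<theta> v g \<longleftrightarrow> (\<forall>n. A n v g)"
    using \<theta> unfolding Pi01_def by blast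
  obtain T where T: "computable (Suc (Suc 0)) T" "\<And>g u. stages (\<lambda>s. T g [s, u]) (\<Delta> g u)"
    using partial_computable_stages[OF \<Delta>] by blast
  \<comment> \<open>\<open>c g v\<close> is the number of values of \<open>\<Delta>\<close> written
    in the first \<open>v\<close> trials; trial \<open>m\<close> asks whether the next value has
    halted by stage \<open>m\<close>.\<close>
  define c where "c g v = rec_nat 0 (\<lambda>m y. if T g [m, y] = 0 then y else Suc y) v" for g v
  have c_simps: "c g 0 = 0" "c g (Suc m) = (if T g [m, c g m] = 0 then c g m else Suc (c g m))"
    for g m by (simp_all add: c_def)
  have c: "computable n (\<lambda>g xs. c g (a g xs))" if "computable n a" for n a
    unfolding c_def by (intro computable_rec that computable_comp[OF T(1)] computable_intros) simp_all
  define x where "x g v = (if v = 0 then Num 0 else if T g [v - 1, c g (v - 1)] = 0 then Pass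
    else Num (T g [v - 1, c g (v - 1)] - 1))" for g v
  \<comment> \<open>The value 2 marks the code of a pass. Nothing is waited for, so \<open>t\<close>
    does not depend on a search stage and \<open>X\<close> is total.\<close>
  define t where "t g v = (if v = 0 then 3 else if T g [v - 1, c g (v - 1)] = 0 then 2
    else T g [v - 1, c g (v - 1)] + 2)" for g v
  define X where "X = (\<lambda>g v. search (\<lambda>s. t g v))"
  have "computable (Suc (Suc 0)) (\<lambda>g ys. t g (tl ys ! 0))"
    unfolding t_def by (intro c computable_comp[OF T(1)] computable_intros) simp_all
  then have X: "partial_computable X" unfolding X_def by (rule partial_computable_search)
  have x: "x g v \<noteq> Sharp" for g v by (simp add: x_def)
  have X_x: "X g v = Some (code (x g v))" for g v
    unfolding X_def by (rule search_Some) (simp_all add: t_def x_def)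
  obtain \<Phi> where \<Phi>: "partial_computable \<Phi>"
    and \<Phi>1: "\<forall>g x. (\<forall>v. \<exists>n. \<not> A n v g) \<longrightarrow> (\<forall>v. X g v = Some (code (x v)) \<and> x v \<noteq> Sharp) \<longrightarrow>
      (\<exists>h. (\<forall>k. \<Phi> g k = Some (code (h k))) \<and> (\<forall>i. walk_seq h i = Some (x (Suc i))) \<and>
        ((\<forall>v. x v \<noteq> Pass) \<longrightarrow> (\<forall>k. h k \<noteq> Pass)))"
    and \<Phi>2: "\<forall>g x v f. (\<forall>w<v. \<exists>n. \<not> A n w g) \<longrightarrow> (\<forall>n. A n v g) \<longrightarrow>
      (\<forall>w\<le>v. X g w = Some (code (x w))) \<longrightarrow> (\<forall>w. x w \<noteq> Sharp) \<longrightarrow>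
      (\<forall>u. \<Gamma> v g u = Some (f u)) \<longrightarrow>
      (\<exists>h. (\<forall>k. \<Phi> g k = Some (code (h k))) \<and> finite {k. h k = Sharp} \<and>
        shift (tail h) = (\<lambda>i. Num (f i)) \<and> ((\<forall>v. x v \<noteq> Pass) \<longrightarrow> (\<forall>k. h k \<noteq> Pass)))"
    by (rule block_functional[OF A \<Gamma> X])
  have "infinite_in (\<Phi> g) (disj_Sigma02 Q P)" if g: "g \<in> R" for g
  proof -
    have "\<exists>h. (\<forall>k. \<Phi> g k = Some (code (h k))) \<and>
        (infinite_in (content_seq (walk_seq h)) (nums Q) \<or>
          finite {k. h k = Sharp} \<and> shift (tail h) \<in> nums P)"
    proof (cases "\<exists>v. \<theta> v g")
      case True
      define v where "v = (LEAST v. \<theta> v g)"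
      have v: "\<theta> v g" "\<And>w. w < v \<Longrightarrow> \<not> \<theta> w g"
        using LeastI_ex[OF True] not_less_Least unfolding v_def by blast+
      obtain f where f: "f \<in> P" "\<And>u. \<Gamma> v g u = Some (f u)"
        using inP[OF g v(1)] unfolding infinite_in_def by blast
      have "\<exists>h. (\<forall>k. \<Phi> g k = Some (code (h k))) \<and> finite {k. h k = Sharp} \<and>
          shift (tail h) = (\<lambda>i. Num (f i)) \<and> ((\<forall>v. x g v \<noteq> Pass) \<longrightarrow> (\<forall>k. h k \<noteq> Pass))"
        by (rule \<Phi>2[rule_format, of v g "x g" f]) (use v \<theta>_A f(2) x X_x in auto)
      then show ?thesis using f(1) unfolding nums_def by blast
    next
      case False
      have "\<exists>h. (\<forall>k. \<Phi> g k = Some (code (h k))) \<and> (\<forall>i. walk_seq h i = Some (x g (Suc i))) \<and>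
          ((\<forall>v. x g v \<noteq> Pass) \<longrightarrow> (\<forall>k. h k \<noteq> Pass))"
        by (rule \<Phi>1[rule_format, of g "x g"]) (use False \<theta>_A x X_x in blast)+
      then obtain h where h: "\<forall>k. \<Phi> g k = Some (code (h k))"
        "\<And>i. walk_seq h i = Some (x g (Suc i))" by blast
      obtain f where f: "f \<in> Q" "\<And>u. \<Delta> g u = Some (f u)"
        using inQ[OF g False] unfolding infinite_in_def by blast
      have st: "stages (\<lambda>s. T g [s, u]) (Some (f u))" for u using T(2)[of g u] f(2) by simp
      have T_val: "T g [s, u] = Suc (f u)" if "T g [s, u] \<noteq> 0" for s u
        using stages_sound[OF st, of s u "T g [s, u] - 1"] that by simp
      have content: "content (map (\<lambda>i. x g (Suc i)) [0..<m]) = map (\<lambda>i. Num (f i)) [0..<c g m]"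
        for m
      proof (induction m)
        case (Suc m)
        have "x g (Suc m) = (if T g [m, c g m] = 0 then Pass else Num (f (c g m)))"
          using T_val[of m "c g m"] by (cases "T g [m, c g m] = 0") (simp_all add: x_def)
        with Suc show ?case by (simp add: c_simps content_def)
      qed (simp add: c_simps content_def)
      \<comment> \<open>No value stays pending forever: from some stage on its computation is seen
        to have halted, and the next trial writes it.\<close>
      have "\<exists>m. i < c g m" for i
      proof (induction i)
        case 0
        obtain r where r: "\<forall>s\<ge>r. T g [s, 0] = Suc (f 0)" using stages_limit[OF st] by blast
        then show ?case by (intro exI[of _ "Suc r"]) (cases "c g r", auto simp: c_simps)
      next
        case (Suc i)
        then obtain m where m: "i < c g m" by blast
        obtain r where r: "\<forall>s\<ge>r. T g [s, Suc i] = Suc (f (Suc i))" using stages_limit[OF st] by blast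
        have "mono (c g)" by (rule mono_iff_le_Suc[THEN iffD2]) (simp add: c_simps)
        then have "c g m \<le> c g (max m r)" by (simp add: mono_def)
        then have "Suc i \<le> c g (max m r)" using m by simp
        then have "Suc i < c g (Suc (max m r))"
          using r by (cases "c g (max m r) = Suc i") (auto simp: c_simps)
        then show ?case by blast
      qed
      then have "content_seq (walk_seq h) i = Some (Num (f i))" for i
        using content_seq_total[of "walk_seq h" "\<lambda>i. x g (Suc i)" "\<lambda>i. Num (f i)" "c g" i,
            OF h(2) content] by blast
      then have "infinite_in (content_seq (walk_seq h)) (nums Q)"
        unfolding infinite_in_nums_iff using f(1) by blast
      with h(1) show ?thesis by blast
    qed
    then obtain h where h: "\<forall>k. \<Phi> g k = Some (code (h k))" and
      "infinite_in (content_seq (walk_seq h)) (nums Q) \<or>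
        finite {k. h k = Sharp} \<and> shift (tail h) \<in> nums P" by blast
    then have "code \<circ> h \<in> disj_Sigma02 Q P" unfolding disj_Sigma02_def by blast
    with h show ?thesis unfolding infinite_in_def by (intro bexI[of _ "code \<circ> h"]) auto
  qed
  with \<Phi> show ?thesis unfolding medvedev_le_def by blast
qed

section \<open>Reading walk and tail back from the disjunction\<close>

text \<open>The \<open>u\<close>-th entry of \<open>content (walk h)\<close> is found from the coded sequence alone: the places
  counted are those of a sharp that is not followed by a pass.\<close>

primrec count_moves :: "(nat \<Rightarrow> nat) \<Rightarrow> nat \<Rightarrow> nat" where
  "count_moves f 0 = 0"
| "count_moves f (Suc k) =
    (if f k = 0 \<and> f (Suc k) \<noteq> 1 then Suc (count_moves f k) else count_moves f k)"

text \<open>A number \<open>n\<close> has code \<open>n + 2\<close>; minus one this is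
  \<open>Suc n\<close>, the marked form that \<open>search\<close> expects.\<close>

definition nth_move :: functional where
  "nth_move f u = search (\<lambda>k. if u < count_moves f (Suc k) then f (Suc k) - 1 else 0)"

lemma code_eq_0_iff: "code a = 0 \<longleftrightarrow> a = Sharp" and code_eq_1_iff: "code a = Suc 0 \<longleftrightarrow> a = Pass"
  by (cases a; simp)+

text \<open>Whether a place counts is decided by the entry after it, so a count over
  \<open>k\<close> places needs \<open>k + 1\<close> entries.\<close>

lemma length_content_walk:
  "length (content (walk (map h [0..<Suc k]))) = count_moves (code \<circ> h) k"
proof (induction k)
  case 0
  show ?case by (simp add: walk_short content_def)
next
  case (Suc k)
  then show ?case
    unfolding walk_map_Suc_Suc
    by (auto simp: content_def code_eq_0_iff code_eq_1_iff simp del: upt_Suc)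
qed

lemma length_content_walk_le:
  assumes "\<And>k. count_moves (code \<circ> h) k \<le> m"
  shows "length (content (walk (map h [0..<n]))) \<le> m"
proof (cases n)
  case 0
  then show ?thesis by (simp add: walk_short content_def)
next
  case (Suc k)
  then show ?thesis using assms by (simp only: length_content_walk)
qed

lemma partial_computable_nth_move: "partial_computable nth_move"
proof -
  have cnt: "computable n (\<lambda>g xs. count_moves g (a g xs))" if "computable n a" for n a
  proof -
    have "computable n (\<lambda>g xs. rec_nat 0
        (\<lambda>k y. if g k = 0 \<and> g (Suc k) \<noteq> 1 then Suc y else y) (a g xs))"
      by (intro computable_rec that computable_oracle computable_intros) simp_all
    moreover have "rec_nat 0 (\<lambda>k y. if g k = 0 \<and> g (Suc k) \<noteq> 1 then Suc y else y) k
        = count_moves g k" for g k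
      by (induction k) simp_all
    ultimately show ?thesis by simp
  qed
  show ?thesis
    unfolding nth_move_def[abs_def]
    by (rule partial_computable_search)
      (intro cnt computable_oracle computable_intros; simp)
qed

text \<open>At the first place where the count exceeds \<open>u\<close> it passes from
  \<open>u\<close> to \<open>u + 1\<close>. So that place holds a sharp, and the entry after it is
  entry \<open>u\<close> of the content.\<close>

lemma nth_move_content:
  assumes f: "\<And>i. content_seq (walk_seq h) i = Some (Num (f i))"
  shows "nth_move (code \<circ> h) u = Some (f u)"
proof -
  let ?\<sigma> = "\<lambda>n. content (walk (map h [0..<n]))" and ?c = "count_moves (code \<circ> h)"
  have chain: "\<exists>zs. ?\<sigma> (Suc n) = ?\<sigma> n @ zs" for n
    using walk_map_Suc[of h n] by (auto simp: content_def simp del: upt_Suc)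
  have nth: "?\<sigma> n ! i = Num (f i)" if "i < length (?\<sigma> n)" for i n
    using union_seq_chain[of ?\<sigma>, OF chain that] f[of i] unfolding content_seq_walk_seq by simp
  have "\<exists>k. u < ?c k"
  proof (rule ccontr)
    assume "\<not> ?thesis"
    then have "length (?\<sigma> n) \<le> u" for n
      by (intro length_content_walk_le) (simp add: not_less)
    then have "union_seq ?\<sigma> u = None" by (rule union_seq_None)
    then show False using f[of u] unfolding content_seq_walk_seq by simp
  qed
  define k where "k = (LEAST k. u < ?c (Suc k))"
  have ex: "\<exists>k. u < ?c (Suc k)"
  proof -
    obtain k where "u < ?c k" using \<open>\<exists>k. u < ?c k\<close> by blast
    then have "k \<noteq> 0" by (cases k) simp_all
    with \<open>u < ?c k\<close> show ?thesis by (metis not0_implies_Suc)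
  qed
  have k: "u < ?c (Suc k)" using LeastI_ex[OF ex] unfolding k_def .
  have "\<not> u < ?c k"
  proof (cases k)
    case (Suc l)
    then show ?thesis using not_less_Least[of l "\<lambda>k. u < ?c (Suc k)"] unfolding k_def by simp
  qed simp
  with k have move: "h k = Sharp" "h (Suc k) \<noteq> Pass" "?c k = u"
    by (auto simp: code_eq_0_iff code_eq_1_iff split: if_splits)
  have "?\<sigma> (Suc (Suc k)) = ?\<sigma> (Suc k) @ [h (Suc k)]"
    unfolding walk_map_Suc_Suc using move by (simp add: content_def del: upt_Suc)
  moreover have "length (?\<sigma> (Suc k)) = u" using move(3) by (simp only: length_content_walk)
  ultimately have "h (Suc k) = Num (f u)"
    using nth[of u "Suc (Suc k)"] by (simp add: nth_append del: upt_Suc)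
  then have val: "code (h (Suc k)) - 1 = Suc (f u)" by simp
  have pos: "(if u < ?c (Suc j) then (code \<circ> h) (Suc j) - 1 else 0) \<noteq> 0 \<longrightarrow> u < ?c (Suc j)" for j
    by (simp split: if_splits)
  \<comment> \<open>\<open>search\<close> would pass over \<open>k\<close> only if the entry after
    it had code 0 or 1; it codes a number, so both least places agree.\<close>
  have "(LEAST j. (if u < ?c (Suc j) then (code \<circ> h) (Suc j) - 1 else 0) \<noteq> 0) = k"
  proof (rule Least_equality)
    show "(if u < ?c (Suc k) then (code \<circ> h) (Suc k) - 1 else 0) \<noteq> 0" using k val by simp
    show "k \<le> j" if "(if u < ?c (Suc j) then (code \<circ> h) (Suc j) - 1 else 0) \<noteq> 0" for j
      using pos that unfolding k_def by (intro Least_le) blast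
  qed
  moreover have "\<exists>j. (if u < ?c (Suc j) then (code \<circ> h) (Suc j) - 1 else 0) \<noteq> 0"
    using k val by (intro exI[of _ k]) simp
  ultimately show ?thesis
    unfolding nth_move_def search_def using k val by (simp only: if_True comp_apply) simp
qed

text \<open>Each entry of the content uses a sharp of its own. So with finitely many sharps,
  membership in the disjunction must come from \<open>P\<close>.\<close>

lemma finite_sharps_content_walk:
  assumes "finite {k. h k = Sharp}"
  shows "\<not> infinite_in (content_seq (walk_seq h)) (nums Q)"
proof
  assume "infinite_in (content_seq (walk_seq h)) (nums Q)"
  then obtain f where "\<And>i. content_seq (walk_seq h) i = Some (Num (f i))"
    unfolding infinite_in_nums_iff by blast
  then have def: "content_seq (walk_seq h) i \<noteq> None" for i by simp
  have "count_moves (code \<circ> h) k \<le> card {j. h j = Sharp \<and> j < k}" for k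
  proof (induction k)
    case (Suc k)
    show ?case
    proof (cases "h k = Sharp")
      case True
      then have "{j. h j = Sharp \<and> j < Suc k} = insert k {j. h j = Sharp \<and> j < k}"
        by (auto simp: less_Suc_eq)
      then have "card {j. h j = Sharp \<and> j < Suc k} = Suc (card {j. h j = Sharp \<and> j < k})"
        by simp
      with Suc show ?thesis by simp
    next
      case False
      then have "{j. h j = Sharp \<and> j < Suc k} = {j. h j = Sharp \<and> j < k}"
        by (auto simp: less_Suc_eq)
      moreover have "count_moves (code \<circ> h) (Suc k) = count_moves (code \<circ> h) k"
        using False by (simp add: code_eq_0_iff)
      ultimately show ?thesis using Suc by (simp only:)
    qed
  qed simp
  moreover have "card {j. h j = Sharp \<and> j < k} \<le> card {j. h j = Sharp}" for k
    using assms by (intro card_mono) auto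
  ultimately have "count_moves (code \<circ> h) k \<le> card {j. h j = Sharp}" for k
    by (meson order_trans)
  then have "length (content (walk (map h [0..<n]))) \<le> card {j. h j = Sharp}" for n
    by (rule length_content_walk_le)
  then have "union_seq (\<lambda>n. content (walk (map h [0..<n]))) (card {j. h j = Sharp}) = None"
    by (rule union_seq_None)
  then show False using def[of "card {j. h j = Sharp}"] unfolding content_seq_walk_seq by simp
qed

lemma Sigma02_imp_b_minus:
  assumes "disj_Sigma02 Q P \<le>\<^sub>M R"
  shows "cond_b_minus P Q R"
proof -
  obtain \<Phi> where \<Phi>: "partial_computable \<Phi>"
    and \<Phi>_in: "\<And>g. g \<in> R \<Longrightarrow> infinite_in (\<Phi> g) (disj_Sigma02 Q P)"
    using assms unfolding medvedev_le_def by blast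
  have "\<exists>h. (\<forall>k. \<Phi> g k = Some (code (h k))) \<and>
      (infinite_in (content_seq (walk_seq h)) (nums Q) \<or>
        finite {k. h k = Sharp} \<and> shift (tail h) \<in> nums P)" if "g \<in> R" for g
  proof -
    obtain f where f: "f \<in> disj_Sigma02 Q P" "\<And>k. \<Phi> g k = Some (f k)"
      using \<Phi>_in[OF \<open>g \<in> R\<close>] unfolding infinite_in_def by blast
    obtain h where h: "f = code \<circ> h" "infinite_in (content_seq (walk_seq h)) (nums Q) \<or>
        finite {k. h k = Sharp} \<and> shift (tail h) \<in> nums P"
      using f(1) unfolding disj_Sigma02_def by blast
    have "\<forall>k. \<Phi> g k = Some (code (h k))" using f(2) by (simp add: h(1))
    with h(2) show ?thesis by blast
  qed
  then obtain H where H: "\<And>g k. g \<in> R \<Longrightarrow> \<Phi> g k = Some (code (H g k))"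
    and disj: "\<And>g. g \<in> R \<Longrightarrow> infinite_in (content_seq (walk_seq (H g))) (nums Q) \<or>
      finite {k. H g k = Sharp} \<and> shift (tail (H g)) \<in> nums P"
    by metis
  obtain T where T: "computable (Suc (Suc 0)) T" "\<And>g u. stages (\<lambda>s. T g [s, u]) (\<Phi> g u)"
    using partial_computable_stages[OF \<Phi>] by blast
  \<comment> \<open>The value 1 says that an entry is known to be a sharp, a larger value that it is
    known not to be one. So \<open>A n v g\<close> says that stage \<open>n\<close> does not refute
    that the tail begins at \<open>v\<close>: no sharp is seen from \<open>v\<close> on, and a sharp
    just before \<open>v\<close> is not excluded unless \<open>v\<close> is 0.\<close>
  define A where "A n v g \<longleftrightarrow>
    (\<forall>k<n. v \<le> k \<longrightarrow> T g [n, k] \<noteq> 1) \<and> (v = 0 \<or> T g [n, v - 1] \<le> 1)" for n v g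
  define \<theta> where "\<theta> v g \<longleftrightarrow> (\<forall>n. A n v g)" for v g
  have "decidable (Suc (Suc 0)) (\<lambda>g xs. A (xs ! 0) (xs ! 1) g)"
    unfolding A_def by (intro computable_comp[OF T(1)] computable_intros) simp_all
  then have \<theta>: "Pi01 \<theta>"
    unfolding Pi01_def \<theta>_def computable_relation_decidable by blast
  have \<theta>_iff: "\<theta> v g \<longleftrightarrow> (\<forall>k\<ge>v. H g k \<noteq> Sharp) \<and> (v = 0 \<or> H g (v - 1) = Sharp)"
    if g: "g \<in> R" for v g
  proof -
    have st: "stages (\<lambda>s. T g [s, k]) (Some (code (H g k)))" for k
      using T(2)[of g k] H[OF g] by simp
    have T_val: "T g [s, k] = Suc (code (H g k))" if "T g [s, k] \<noteq> 0" for s k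
      using stages_sound[OF st, of s k "T g [s, k] - 1"] that by simp
    show ?thesis
    proof
      assume \<theta>: "\<theta> v g"
      have "H g k \<noteq> Sharp" if "v \<le> k" for k
      proof
        assume "H g k = Sharp"
        moreover obtain r where "\<forall>s\<ge>r. T g [s, k] = Suc (code (H g k))"
          using stages_limit[OF st] by blast
        \<comment> \<open>The stage must exceed \<open>k\<close>, as \<open>A n\<close> looks for
          sharps only below \<open>n\<close>.\<close>
        ultimately have "T g [max r (Suc k), k] = 1" by simp
        moreover have "A (max r (Suc k)) v g" using \<theta> unfolding \<theta>_def by blast
        ultimately show False using that unfolding A_def by auto
      qed
      moreover have "v = 0 \<or> H g (v - 1) = Sharp"
      proof -
        obtain r where "\<forall>s\<ge>r. T g [s, v - 1] = Suc (code (H g (v - 1)))"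
          using stages_limit[OF st] by blast
        moreover have "A r v g" using \<theta> unfolding \<theta>_def by blast
        ultimately show ?thesis unfolding A_def by (auto simp: code_eq_0_iff)
      qed
      ultimately show "(\<forall>k\<ge>v. H g k \<noteq> Sharp) \<and> (v = 0 \<or> H g (v - 1) = Sharp)" by blast
    next
      assume v: "(\<forall>k\<ge>v. H g k \<noteq> Sharp) \<and> (v = 0 \<or> H g (v - 1) = Sharp)"
      have "A n v g" for n
        unfolding A_def
      proof (intro conjI allI impI)
        fix k assume "v \<le> k"
        then have "code (H g k) \<noteq> 0" using v by (simp add: code_eq_0_iff)
        then show "T g [n, k] \<noteq> 1" using T_val[of n k] by auto
      next
        show "v = 0 \<or> T g [n, v - 1] \<le> 1" using v T_val[of n "v - 1"] by fastforce
      qed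
      then show "\<theta> v g" unfolding \<theta>_def by blast
    qed
  qed
  \<comment> \<open>\<open>Suc (v + u)\<close> skips the first entry of the tail. The marked code of
    a number \<open>y\<close> is \<open>y + 3\<close>, so subtracting 2 gives
    \<open>Suc y\<close>.\<close>
  define \<Gamma> where "\<Gamma> = (\<lambda>v g u. search (\<lambda>s. T g [s, Suc (v + u)] - 2))"
  have \<Gamma>: "uniformly_computable \<Gamma>"
  proof -
    have "computable (Suc (Suc (Suc 0)))
        (\<lambda>g ys. T g [ys ! 0, Suc (tl ys ! 0 + tl ys ! 1)] - 2)"
      by (intro computable_comp[OF T(1)] computable_intros) simp_all
    then obtain e where "\<And>g xs. length xs = Suc (Suc 0) \<Longrightarrow>
        peval e g xs = search (\<lambda>s. T g [s, Suc (xs ! 0 + xs ! 1)] - 2)"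
      using peval_search[of "Suc (Suc 0)" "\<lambda>g s xs. T g [s, Suc (xs ! 0 + xs ! 1)] - 2"] by blast
    then have "\<forall>v g u. \<Gamma> v g u = peval e g [v, u]" by (simp add: \<Gamma>_def)
    then show ?thesis unfolding uniformly_computable_def by blast
  qed
  obtain \<Delta> where \<Delta>: "partial_computable \<Delta>"
    "\<And>g h. (\<And>k. \<Phi> g k = Some (h k)) \<Longrightarrow> \<Delta> g = nth_move h"
    using partial_computable_substitute[OF \<Phi> partial_computable_nth_move] by blast
  have inP: "(\<forall>u. \<Gamma> v g u \<noteq> None) \<and> infinite_in (\<Gamma> v g) P" if g: "g \<in> R" and "\<theta> v g" for g v
  proof -
    have v: "\<And>k. v \<le> k \<Longrightarrow> H g k \<noteq> Sharp" "v = 0 \<or> H g (v - 1) = Sharp"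
      using \<theta>_iff[OF g] \<open>\<theta> v g\<close> by blast+
    have "{k. H g k = Sharp} \<subseteq> {..<v}" using v(1) by (auto simp: not_le[symmetric])
    then have fin: "finite {k. H g k = Sharp}" by (rule finite_subset) simp
    have "(LEAST n. \<forall>k\<ge>n. H g k \<noteq> Sharp) = v"
    proof (rule Least_equality)
      show "\<forall>k\<ge>v. H g k \<noteq> Sharp" using v(1) by blast
      show "v \<le> n" if "\<forall>k\<ge>n. H g k \<noteq> Sharp" for n
        using that v(2) by (cases v) (auto simp: not_less_eq_eq[symmetric])
    qed
    then have "shift (tail (H g)) = (\<lambda>i. H g (Suc (v + i)))" by (simp add: shift_def tail_def)
    moreover have "shift (tail (H g)) \<in> nums P"
      using disj[OF g] finite_sharps_content_walk[OF fin] by blast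
    ultimately obtain f where f: "f \<in> P" "\<And>i. H g (Suc (v + i)) = Num (f i)"
      unfolding nums_def by (auto dest: fun_cong)
    have "\<Gamma> v g u = Some (f u)" for u
      unfolding \<Gamma>_def
    proof (rule search_Some)
      have st: "stages (\<lambda>s. T g [s, Suc (v + u)]) (Some (f u + 2))"
        using T(2)[of g "Suc (v + u)"] H[OF g] f(2) by simp
      obtain s where "T g [s, Suc (v + u)] = Suc (f u + 2)" using st by (rule stages_halts)
      then have "T g [s, Suc (v + u)] - 2 \<noteq> 0" by simp
      then show "\<exists>s. T g [s, Suc (v + u)] - 2 \<noteq> 0" by blast
      show "T g [s, Suc (v + u)] - 2 = Suc (f u)" if "T g [s, Suc (v + u)] - 2 \<noteq> 0" for s
        using stages_sound[OF st, of s "T g [s, Suc (v + u)] - 1"] that by simp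
    qed
    then show ?thesis unfolding infinite_in_def by (auto intro!: bexI[OF _ f(1)])
  qed
  have inQ: "(\<forall>u. \<Delta> g u \<noteq> None) \<and> infinite_in (\<Delta> g) Q"
    if g: "g \<in> R" and no: "\<not> (\<exists>v. \<theta> v g)" for g
  proof -
    \<comment> \<open>With finitely many sharps the start of the tail would satisfy
      \<open>\<theta>\<close>, since minimality puts a sharp just before it.\<close>
    have "\<not> finite {k. H g k = Sharp}"
    proof
      assume "finite {k. H g k = Sharp}"
      then obtain b where b: "\<forall>k\<in>{k. H g k = Sharp}. k < b"
        using finite_nat_set_iff_bounded by blast
      then have ex: "\<exists>n. \<forall>k\<ge>n. H g k \<noteq> Sharp" by (metis mem_Collect_eq not_le)
      define v where "v = (LEAST n. \<forall>k\<ge>n. H g k \<noteq> Sharp)"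
      have v: "\<forall>k\<ge>v. H g k \<noteq> Sharp" using LeastI_ex[OF ex] unfolding v_def .
      have "H g (v - 1) = Sharp" if "v \<noteq> 0"
      proof (rule ccontr)
        assume "H g (v - 1) \<noteq> Sharp"
        then have "\<forall>k\<ge>v - 1. H g k \<noteq> Sharp"
          using v that by (metis Suc_pred' le_eq_less_or_eq less_eq_Suc_le neq0_conv)
        then have "v \<le> v - 1" unfolding v_def by (rule Least_le)
        with that show False by simp
      qed
      with v have "\<theta> v g" unfolding \<theta>_iff[OF g] by blast
      with no show False by blast
    qed
    then have "infinite_in (content_seq (walk_seq (H g))) (nums Q)" using disj[OF g] by blast
    then obtain f where f: "f \<in> Q" "\<And>i. content_seq (walk_seq (H g)) i = Some (Num (f i))"
      unfolding infinite_in_nums_iff by blast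
    have "\<Delta> g = nth_move (code \<circ> H g)" by (rule \<Delta>(2)) (simp add: H[OF g])
    then have "\<Delta> g u = Some (f u)" for u using nth_move_content[OF f(2)] by simp
    then show ?thesis unfolding infinite_in_def by (auto intro!: bexI[OF _ f(1)])
  qed
  show ?thesis
    unfolding cond_b_minus_def
    by (intro exI[of _ \<theta>] exI[of _ \<Gamma>] exI[of _ \<Delta>] conjI[OF \<theta>] conjI[OF \<Gamma>] conjI[OF \<Delta>(1)])
      (simp add: inP inQ del: not_None_eq)
qed

theorem theorem4p6:
  fixes P Q R :: "(nat \<Rightarrow> nat) set"
  shows "(cond_b_plus P Q R \<longrightarrow> disj_bowtie Q P \<le>\<^sub>M R) \<and>
    (disj_bowtie Q P \<le>\<^sub>M R \<longrightarrow> disj_Sigma02 Q P \<le>\<^sub>M R) \<and>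
    (disj_Sigma02 Q P \<le>\<^sub>M R \<longleftrightarrow> cond_b_minus P Q R)"
proof -
  have "disj_Sigma02 Q P \<le>\<^sub>M R" if "disj_bowtie Q P \<le>\<^sub>M R"
    using that disj_bowtie_subset[of Q P] unfolding medvedev_le_def infinite_in_def by (meson subsetD)
  then show ?thesis
    using b_plus_imp_bowtie b_minus_imp_Sigma02 Sigma02_imp_b_minus by blast
qed

end
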